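(* Fix a constant integer $d \geq 1$. There exist a function $\delta:\mathbb{N}\to[0,1]$ with $\delta(n)\to 0$ as $n\to\infty$ and a constant $c>0$ (depending only on $d$) such that for all sufficiently large $n$ the following holds. Let $A$ be any algorithm which is given access to i.i.d. samples from an unknown distribution $\mathcal{D}$ and has the following performance guarantee: (1) if $\mathcal{D} = \mathcal{D}_u$, then with probability at least $99/100$ the algorithm $A$ outputs "un-truncated"; and (2) if $\mathcal{D} = \mathcal{D}_u|_{f^{-1}(1)}$, where $f:\{-1,1\}^n\to\{0,1\}$ is a degree-$d$ polynomial threshold function with $\mathrm{vol}(f) \in [1/2-\delta(n),\, 1/2+\delta(n)]$, then with probability at least $99/100$ the algorithm $A$ outputs "truncated". Then $A$ must use at least $c\, n^{d/2}$ samples from $\mathcal{D}$.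
   Context: $\mathcal{D}_u$ denotes the uniform distribution over the Boolean hypercube $\{-1,1\}^n$. A function $f:\{-1,1\}^n\to\{0,1\}$ is a degree-$d$ polynomial threshold function (PTF) if there is a real polynomial $p$ of degree at most $d$ with $f(x)=\mathbf{1}\{p(x)\geq 0\}$ for all $x$. $\mathrm{vol}(f) := \mathbb{E}_{x\sim\mathcal{D}_u}[f(x)]$. For $f$ with $\mathrm{vol}(f)>0$, $\mathcal{D}_u|_{f^{-1}(1)}$ denotes the uniform distribution conditioned on $f(x)=1$ (i.e. uniform over $f^{-1}(1)$). *)

theory Defs
  imports "HOL-Probability.Probability" "HOL-Library.Poly_Mapping"
begin

(* A point of R^n is an extensional function on {..<n}, so that the dimension n can be
   quantified over inside formulas. *)
type_synonym point = "nat \<Rightarrow> real"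

definition hypercube :: "nat \<Rightarrow> point set" where
  "hypercube n = {..<n} \<rightarrow>\<^sub>E {-1, 1}"

lemma finite_hypercube: "finite (hypercube n)"
  by (simp add: hypercube_def finite_PiE)

lemma hypercube_nonempty: "hypercube n \<noteq> {}"
  by (simp add: hypercube_def PiE_eq_empty_iff)

definition uniform_hypercube :: "nat \<Rightarrow> point pmf" where
  "uniform_hypercube n = pmf_of_set (hypercube n)"

(* Multivariate real polynomials: a finitely supported map from monomials to coefficients,
   where a monomial is a finitely supported map from variable indices to exponents. *)
type_synonym real_mpoly = "(nat \<Rightarrow>\<^sub>0 nat) \<Rightarrow>\<^sub>0 real"

definition monomial_degree :: "(nat \<Rightarrow>\<^sub>0 nat) \<Rightarrow> nat" where
  "monomial_degree t = (\<Sum>i\<in>Poly_Mapping.keys t. Poly_Mapping.lookup t i)"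

definition mpolys_upto :: "nat \<Rightarrow> nat \<Rightarrow> real_mpoly set" where
  "mpolys_upto n d =
     {p. \<forall>t\<in>Poly_Mapping.keys p. Poly_Mapping.keys t \<subseteq> {..<n} \<and> monomial_degree t \<le> d}"

definition mpoly_eval :: "real_mpoly \<Rightarrow> point \<Rightarrow> real" where
  "mpoly_eval p x =
     (\<Sum>t\<in>Poly_Mapping.keys p. Poly_Mapping.lookup p t *
        (\<Prod>i\<in>Poly_Mapping.keys t. x i ^ Poly_Mapping.lookup t i))"

(* Only the values of f on the hypercube are constrained (and used below). *)
definition is_ptf :: "nat \<Rightarrow> nat \<Rightarrow> (point \<Rightarrow> real) \<Rightarrow> bool" where
  "is_ptf n d f \<longleftrightarrow>
     (\<exists>p\<in>mpolys_upto n d. \<forall>x\<in>hypercube n. f x = of_bool (mpoly_eval p x \<ge> 0))"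

definition vol :: "nat \<Rightarrow> (point \<Rightarrow> real) \<Rightarrow> real" where
  "vol n f = measure_pmf.expectation (uniform_hypercube n) f"

(* Meaningful only if vol n f > 0: cond_pmf is unspecified for events of probability 0. *)
definition truncated_uniform :: "nat \<Rightarrow> (point \<Rightarrow> real) \<Rightarrow> point pmf" where
  "truncated_uniform n f = cond_pmf (uniform_hypercube n) {x. f x = 1}"

datatype verdict = Untruncated | Truncated

(* An algorithm using m samples is a randomized map from lists of m samples to verdicts;
   the inner pmf is its internal randomness. No computability or running time restriction
   is imposed. *)
type_synonym algorithm = "point list \<Rightarrow> verdict pmf"

definition run_algorithm :: "nat \<Rightarrow> algorithm \<Rightarrow> point pmf \<Rightarrow> verdict pmf" where
  "run_algorithm m A D = bind_pmf (replicate_pmf m D) A"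

definition truncation_tester :: "nat \<Rightarrow> nat \<Rightarrow> real \<Rightarrow> nat \<Rightarrow> algorithm \<Rightarrow> bool" where
  "truncation_tester n d \<epsilon> m A \<longleftrightarrow>
     pmf (run_algorithm m A (uniform_hypercube n)) Untruncated \<ge> 99/100 \<and>
     (\<forall>f. is_ptf n d f \<and> vol n f > 0 \<and> vol n f \<in> {1/2 - \<epsilon> .. 1/2 + \<epsilon>} \<longrightarrow>
        pmf (run_algorithm m A (truncated_uniform n f)) Truncated \<ge> 99/100)"

end

theory Submission
  imports Defs
begin

text \<open>
  Draw \<open>f(x) = 1{\<langle>a, \<phi>(x)\<rangle> \<ge> 0}\<close> with \<open>a\<close> a standard Gaussian vector and \<open>\<phi>(x)\<close> the vector of all
  multilinear monomials that take one variable from each of \<open>d\<close> blocks of \<open>N = \<lfloor>n/d\<rfloor>\<close> coordinates, so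
  that there are \<open>D = N\<^sup>d\<close> of them. Negating the first block negates \<open>\<phi>(x)\<close>, so almost surely
  the volume is exactly \<open>1/2\<close> and \<open>\<delta> = 0\<close> works. Let \<open>K\<close> be the likelihood ratio between \<open>m\<close> samples
  from the resulting mixture and \<open>m\<close> uniform samples. A tester forces the relative entropy
  \<open>E[K ln K]\<close> to be at least \<open>0.97\<close>. On the other hand the chain rule bounds the entropy by \<open>2m\<^sup>2/D\<close>:
  given the values of \<open>\<langle>a, \<phi>\<rangle>\<close> at \<open>k\<close> earlier samples, \<open>\<langle>a, \<phi>(x)\<rangle>\<close> is Gaussian with variance
  \<open>D - |\<Pi>\<phi>(x)|\<^sup>2\<close> and mean \<open>\<langle>a, \<Pi>\<phi>(x)\<rangle>\<close>, where \<open>\<Pi>\<close> projects to the span of the earlier features.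
  As \<open>E[\<phi>(x) \<phi>(x)\<^sup>T]\<close> is the identity, \<open>E|\<Pi>\<phi>(x)|\<^sup>2 \<le> k\<close>, so that the sign of the new value has squared
  conditional bias \<open>O(k/D)\<close> on average.
\<close>

subsection \<open>Gaussian vectors\<close>

definition dot :: "'i set \<Rightarrow> ('i \<Rightarrow> real) \<Rightarrow> ('i \<Rightarrow> real) \<Rightarrow> real" where
  "dot I a b = (\<Sum>i\<in>I. a i * b i)"

text \<open>A density against Lebesgue measure, rather than a product of normal laws, so that
  integrals can be moved along lines by translation invariance before the exponent is
  treated.\<close>

definition gauss :: "'i set \<Rightarrow> ('i \<Rightarrow> real) measure" where
  "gauss I = density (Pi\<^sub>M I (\<lambda>_. lborel)) (\<lambda>a. \<Prod>i\<in>I. ennreal (std_normal_density (a i)))"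

lemma sets_gauss [measurable_cong]: "sets (gauss I) = sets (Pi\<^sub>M I (\<lambda>_. lborel))"
  by (simp add: gauss_def)

lemma space_gauss: "space (gauss I) = extensional I"
  by (simp add: gauss_def space_PiM PiE_def)

lemma measurable_dot [measurable]:
  assumes "finite I"
  shows "(\<lambda>a. dot I a b) \<in> borel_measurable (Pi\<^sub>M I (\<lambda>_. lborel))"
  unfolding dot_def by measurable

interpretation lborel_product: product_sigma_finite "\<lambda>_::'i. lborel :: real measure"
  by standard

section \<open>Lebesgue measure along parallel lines\<close>

text \<open>Induction on the coordinates: the new one is shifted by the one-dimensional
  substitution, and the induction hypothesis for the partial integral \<open>F'\<close> shifts the
  others.\<close>

lemma nn_integral_PiM_lborel_translate:
  assumes "finite I" and "F \<in> borel_measurable (Pi\<^sub>M I (\<lambda>_. lborel))"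
  shows "(\<integral>\<^sup>+a. F (\<lambda>i\<in>I. a i + v i) \<partial>Pi\<^sub>M I (\<lambda>_. lborel)) = (\<integral>\<^sup>+a. F a \<partial>Pi\<^sub>M I (\<lambda>_. lborel :: real measure))"
  using assms
proof (induction I arbitrary: F)
  case empty
  then show ?case by (simp add: space_PiM nn_integral_count_space_finite PiM_empty)
next
  case (insert i I)
  note [measurable] = insert.prems
  define F' where "F' x = (\<integral>\<^sup>+y. F (x(i := y)) \<partial>lborel)" for x
  have [measurable]: "F' \<in> borel_measurable (Pi\<^sub>M I (\<lambda>_. lborel))"
    unfolding F'_def by measurable
  have [measurable]: "(\<lambda>a. F (\<lambda>j\<in>insert i I. a j + v j)) \<in> borel_measurable (Pi\<^sub>M (insert i I) (\<lambda>_. lborel))"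
    by measurable
  have inner: "(\<integral>\<^sup>+y. F (\<lambda>j\<in>insert i I. (x(i := y)) j + v j) \<partial>lborel) = F' (\<lambda>j\<in>I. x j + v j)" for x
  proof -
    have "(\<lambda>j\<in>I. x j + v j) \<in> space (Pi\<^sub>M I (\<lambda>_. lborel))" by (simp add: space_PiM)
    from measurable_comp[OF measurable_component_update[OF this insert.hyps(2)] insert.prems]
    have [measurable]: "(\<lambda>y. F ((\<lambda>j\<in>I. x j + v j)(i := y))) \<in> borel_measurable borel"
      by (simp add: comp_def)
    have "(\<lambda>j\<in>insert i I. (x(i := y)) j + v j) = (\<lambda>j\<in>I. x j + v j)(i := v i + 1 * y)" for y
      using insert.hyps(2) by (auto simp: restrict_def)
    then have "(\<integral>\<^sup>+y. F (\<lambda>j\<in>insert i I. (x(i := y)) j + v j) \<partial>lborel)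
      = (\<integral>\<^sup>+y. F ((\<lambda>j\<in>I. x j + v j)(i := v i + 1 * y)) \<partial>lborel)" by simp
    also have "\<dots> = F' (\<lambda>j\<in>I. x j + v j)"
      unfolding F'_def by (subst nn_integral_real_affine[where c = 1 and t = "v i"]) simp_all
    finally show ?thesis .
  qed
  have "(\<integral>\<^sup>+a. F (\<lambda>j\<in>insert i I. a j + v j) \<partial>Pi\<^sub>M (insert i I) (\<lambda>_. lborel))
      = (\<integral>\<^sup>+x. F' (\<lambda>j\<in>I. x j + v j) \<partial>Pi\<^sub>M I (\<lambda>_. lborel))"
    using insert.hyps by (subst lborel_product.product_nn_integral_insert) (measurable, simp only: inner)
  also have "\<dots> = (\<integral>\<^sup>+x. F' x \<partial>Pi\<^sub>M I (\<lambda>_. lborel))"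
    by (rule insert.IH) measurable
  also have "\<dots> = (\<integral>\<^sup>+a. F a \<partial>Pi\<^sub>M (insert i I) (\<lambda>_. lborel))"
    unfolding F'_def using insert.hyps by (subst lborel_product.product_nn_integral_insert) simp_all
  finally show ?case .
qed

text \<open>A shear: substituting \<open>y = w i * t\<close> in coordinate \<open>i\<close> produces
  the factor \<open>\<bar>w i\<bar>\<close>, and for fixed \<open>t\<close> the other coordinates
  are translated by \<open>t * w j\<close>. The points \<open>b(i := 0)\<close> form a hyperplane
  transversal to \<open>w\<close> and so index the lines with direction \<open>w\<close>.\<close>

lemma nn_integral_PiM_lborel_fibres:
  assumes I: "finite I" "i \<notin> I" and wi: "w i \<noteq> 0"
    and [measurable]: "F \<in> borel_measurable (Pi\<^sub>M (insert i I) (\<lambda>_. lborel))"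
  shows "(\<integral>\<^sup>+a. F a \<partial>Pi\<^sub>M (insert i I) (\<lambda>_. lborel)) =
    ennreal \<bar>w i\<bar> * (\<integral>\<^sup>+b. \<integral>\<^sup>+t. F (\<lambda>j\<in>insert i I. (b(i := 0)) j + t * w j) \<partial>lborel \<partial>Pi\<^sub>M I (\<lambda>_. lborel :: real measure))"
proof -
  have meas: "(\<lambda>y. \<integral>\<^sup>+x. F (x(i := y)) \<partial>Pi\<^sub>M I (\<lambda>_. lborel)) \<in> borel_measurable borel"
    by (rule sigma_finite_measure.borel_measurable_nn_integral[OF lborel_product.sigma_finite[OF I(1)], where N = borel])
      (use I in measurable)
  have upd: "(\<lambda>x. F (x(i := y))) \<in> borel_measurable (Pi\<^sub>M I (\<lambda>_. lborel))" for y
    by measurable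
  have "(\<integral>\<^sup>+a. F a \<partial>Pi\<^sub>M (insert i I) (\<lambda>_. lborel))
     = (\<integral>\<^sup>+y. \<integral>\<^sup>+x. F (x(i := y)) \<partial>Pi\<^sub>M I (\<lambda>_. lborel) \<partial>lborel)"
    using I by (subst lborel_product.product_nn_integral_insert_rev) simp_all
  also have "\<dots> = \<bar>w i\<bar> * (\<integral>\<^sup>+t. \<integral>\<^sup>+x. F (x(i := 0 + w i * t)) \<partial>Pi\<^sub>M I (\<lambda>_. lborel) \<partial>lborel)"
    by (rule nn_integral_real_affine[OF meas wi])
  also have "(\<lambda>t. \<integral>\<^sup>+x. F (x(i := 0 + w i * t)) \<partial>Pi\<^sub>M I (\<lambda>_. lborel)) =
      (\<lambda>t. \<integral>\<^sup>+b. F (\<lambda>j\<in>insert i I. (b(i := 0)) j + t * w j) \<partial>Pi\<^sub>M I (\<lambda>_. lborel))"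
  proof (rule ext)
    fix t :: real
    have "(\<lambda>j\<in>insert i I. (b(i := 0)) j + t * w j) = (\<lambda>j\<in>I. b j + t * w j)(i := 0 + w i * t)" for b
      using I(2) by (auto simp: restrict_def)
    then show "(\<integral>\<^sup>+x. F (x(i := 0 + w i * t)) \<partial>Pi\<^sub>M I (\<lambda>_. lborel)) =
        (\<integral>\<^sup>+b. F (\<lambda>j\<in>insert i I. (b(i := 0)) j + t * w j) \<partial>Pi\<^sub>M I (\<lambda>_. lborel))"
      using nn_integral_PiM_lborel_translate[OF I(1) upd[of "0 + w i * t"], of "\<lambda>j. t * w j"] by simp
  qed
  also have "(\<integral>\<^sup>+t. \<integral>\<^sup>+b. F (\<lambda>j\<in>insert i I. (b(i := 0)) j + t * w j) \<partial>Pi\<^sub>M I (\<lambda>_. lborel) \<partial>lborel)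
     = (\<integral>\<^sup>+b. \<integral>\<^sup>+t. F (\<lambda>j\<in>insert i I. (b(i := 0)) j + t * w j) \<partial>lborel \<partial>Pi\<^sub>M I (\<lambda>_. lborel))"
  proof (rule pair_sigma_finite.Fubini')
    show "pair_sigma_finite (Pi\<^sub>M I (\<lambda>_. lborel :: real measure)) (lborel :: real measure)"
      by (intro pair_sigma_finite.intro lborel_product.sigma_finite I lborel.sigma_finite_measure_axioms)
    show "(\<lambda>(b, t). F (\<lambda>j\<in>insert i I. (b(i := 0)) j + t * w j))
        \<in> borel_measurable (Pi\<^sub>M I (\<lambda>_. lborel) \<Otimes>\<^sub>M lborel)"
      by measurable
  qed
  finally show ?thesis .
qed

section \<open>Splitting a Gaussian vector along a direction\<close>

lemma prod_std_normal_density: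
  assumes "finite I"
  shows "(\<Prod>i\<in>I. std_normal_density (a i)) = (1 / sqrt (2 * pi)) ^ card I * exp (- dot I a a / 2)"
  using assms
  by (simp add: normal_density_def prod.distrib prod_dividef exp_sum [symmetric] sum_divide_distrib sum_negf
      dot_def power2_eq_square power_one_over)

lemma dot_add_scale_left: "dot I (\<lambda>i. a i + t * b i) c = dot I a c + t * dot I b c"
  by (simp add: dot_def sum.distrib sum_distrib_left algebra_simps)

lemma dot_restrict [simp]: "dot I (restrict a I) b = dot I a b" "dot I a (restrict b I) = dot I a b"
  by (simp_all add: dot_def)

lemma dot_commute: "dot I a b = dot I b a"
  by (simp add: dot_def mult.commute)

text \<open>The substitution \<open>\<xi> = B / s + s * t\<close>. With
  \<open>s\<^sup>2 = dot J w w\<close> and \<open>B = dot J b w\<close>, the argument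
  \<open>B + t * s\<^sup>2\<close> is the inner product of \<open>b + t w\<close> with
  \<open>w\<close>.\<close>

lemma std_normal_affine:
  fixes B s k :: real and f :: "real \<Rightarrow> ennreal"
  assumes s: "s > 0" and [measurable]: "f \<in> borel_measurable borel"
  shows "(\<integral>\<^sup>+t. ennreal (std_normal_density (B / s + s * t)) * f (B + t * s\<^sup>2) \<partial>lborel)
     = ennreal (1 / s) * (\<integral>\<^sup>+\<xi>. f (s * \<xi>) \<partial>std_normal_distribution)"
proof -
  have "(\<integral>\<^sup>+\<xi>. f (s * \<xi>) \<partial>std_normal_distribution) =
      (\<integral>\<^sup>+\<xi>. ennreal (std_normal_density \<xi>) * f (s * \<xi>) \<partial>lborel)"
    by (subst nn_integral_density) auto
  also have "\<dots> = ennreal s * (\<integral>\<^sup>+t. ennreal (std_normal_density (B / s + s * t)) * f (s * (B / s + s * t)) \<partial>lborel)"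
    using s by (subst nn_integral_real_affine[where c = s and t = "B / s"]) auto
  also have "(\<lambda>t. s * (B / s + s * t)) = (\<lambda>t. B + t * s\<^sup>2)"
    using s by (auto simp: field_simps power2_eq_square)
  finally show ?thesis
    using s by (simp add: mult.assoc[symmetric] ennreal_mult[symmetric] fun_eq_iff)
qed

lemma prob_space_std_normal: "prob_space std_normal_distribution"
  by (rule prob_space_normal_density) simp

text \<open>Disintegration along the lines with direction \<open>w\<close>; the kernel \<open>K\<close> does not depend on \<open>H\<close>.\<close>

lemma nn_integral_gauss_fibres:
  fixes w :: "'i \<Rightarrow> real"
  assumes I: "finite I" "i \<notin> I" and wi: "w i \<noteq> 0"
  obtains K where "K \<in> borel_measurable (Pi\<^sub>M I (\<lambda>_. lborel))"
    and "\<And>H. case_prod H \<in> borel_measurable (Pi\<^sub>M (insert i I) (\<lambda>_. lborel) \<Otimes>\<^sub>M borel) \<Longrightarrow>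
      (\<And>a t y. a \<in> extensional (insert i I) \<Longrightarrow> H (\<lambda>j\<in>insert i I. a j + t * w j) y = H a y) \<Longrightarrow>
      (\<integral>\<^sup>+a. H a (dot (insert i I) a w) \<partial>gauss (insert i I)) =
      (\<integral>\<^sup>+b. K b * (\<integral>\<^sup>+\<xi>. H (b(i := 0)) (sqrt (dot (insert i I) w w) * \<xi>) \<partial>std_normal_distribution)
         \<partial>Pi\<^sub>M I (\<lambda>_. lborel))"
proof
  define J where "J = insert i I"
  have J: "finite J" "i \<in> J" using I by (auto simp: J_def)
  define W where "W = dot J w w"
  define s where "s = sqrt W"
  have "W > 0"
    unfolding W_def dot_def using J wi by (intro sum_pos2[of _ i]) (auto simp: zero_less_mult_iff linorder_neq_iff)
  then have s: "s > 0" "s\<^sup>2 = W" by (auto simp: s_def)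
  \<comment> \<open>The part of the density that is constant along a line: the exponent is minus
    half the squared length of the component of \<open>b(i := 0)\<close> orthogonal to
    \<open>w\<close>, and the extra \<open>sqrt (2 * pi)\<close> makes room for the normalisation of
    the one-dimensional density.\<close>
  define k :: "('i \<Rightarrow> real) \<Rightarrow> real" where "k b = (1 / sqrt (2 * pi)) ^ card J * sqrt (2 * pi) *
      exp (- (dot J (b(i := 0)) (b(i := 0)) - (dot J (b(i := 0)) w)\<^sup>2 / W) / 2)" for b
  have k_nonneg: "k b \<ge> 0" for b
    by (simp add: k_def)
  \<comment> \<open>Here \<open>\<bar>w i\<bar>\<close> is the Jacobian of the shear and
    \<open>1 / s\<close> that of \<open>std_normal_affine\<close>.\<close>
  define K where "K b = ennreal \<bar>w i\<bar> * (ennreal (k b) * ennreal (1 / s))" for b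
  have [measurable]: "(\<lambda>b. dot J (b(i := 0)) (b(i := 0))) \<in> borel_measurable (Pi\<^sub>M I (\<lambda>_. lborel))"
    "(\<lambda>b. dot J (b(i := 0)) w) \<in> borel_measurable (Pi\<^sub>M I (\<lambda>_. lborel))"
    unfolding dot_def J_def using I by (simp_all add: sum.insert_remove cong: sum.cong) measurable
  have k_meas [measurable]: "k \<in> borel_measurable (Pi\<^sub>M I (\<lambda>_. lborel))"
    unfolding k_def by measurable
  show "K \<in> borel_measurable (Pi\<^sub>M I (\<lambda>_. lborel))"
    unfolding K_def by measurable
  have upd_meas [measurable]: "(\<lambda>b. b(i := 0)) \<in> measurable (Pi\<^sub>M I (\<lambda>_. lborel)) (Pi\<^sub>M J (\<lambda>_. lborel :: real measure))"
    unfolding J_def by measurable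
  fix H :: "('i \<Rightarrow> real) \<Rightarrow> real \<Rightarrow> ennreal"
  assume H: "case_prod H \<in> borel_measurable (Pi\<^sub>M (insert i I) (\<lambda>_. lborel) \<Otimes>\<^sub>M borel)"
    and inv: "\<And>a t y. a \<in> extensional (insert i I) \<Longrightarrow> H (\<lambda>j\<in>insert i I. a j + t * w j) y = H a y"
  note [measurable] = H[folded J_def]
  interpret N: prob_space std_normal_distribution by (rule prob_space_std_normal)
  have dens: "(\<Prod>j\<in>J. ennreal (std_normal_density (b j + t * w j))) =
      ennreal ((1 / sqrt (2 * pi)) ^ card J * exp (- (dot J b b + 2 * t * dot J b w + t\<^sup>2 * W) / 2))" for b t
  proof -
    have "dot J (\<lambda>j. b j + t * w j) (\<lambda>j. b j + t * w j) = dot J b b + 2 * t * dot J b w + t\<^sup>2 * W"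
      unfolding dot_def W_def by (simp add: algebra_simps power2_eq_square sum.distrib sum_distrib_left)
    then show ?thesis
      using prod_std_normal_density[OF J(1), of "\<lambda>j. b j + t * w j"] by (simp add: prod_ennreal)
  qed
  have complete_square: "(\<Prod>j\<in>J. ennreal (std_normal_density ((b(i := 0)) j + t * w j))) =
      ennreal (k b) * ennreal (std_normal_density (dot J (b(i := 0)) w / s + s * t))" for b t
  proof -
    let ?b = "b(i := 0)"
    have "- (dot J ?b ?b + 2 * t * dot J ?b w + t\<^sup>2 * W) / 2 =
        - (dot J ?b ?b - (dot J ?b w)\<^sup>2 / W) / 2 + (- (dot J ?b w / s + s * t)\<^sup>2 / 2)"
    proof -
      have "(dot J ?b w / s + s * t)\<^sup>2 = (dot J ?b w)\<^sup>2 / s\<^sup>2 + 2 * t * dot J ?b w + t\<^sup>2 * s\<^sup>2"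
        using s(1) by (simp add: power2_sum power_divide power_mult_distrib)
      then show ?thesis unfolding s(2) by (simp add: field_simps)
    qed
    then have "exp (- (dot J ?b ?b + 2 * t * dot J ?b w + t\<^sup>2 * W) / 2) =
        exp (- (dot J ?b ?b - (dot J ?b w)\<^sup>2 / W) / 2) * exp (- (dot J ?b w / s + s * t)\<^sup>2 / 2)"
      by (simp only: exp_add)
    then have "(1 / sqrt (2 * pi)) ^ card J * exp (- (dot J ?b ?b + 2 * t * dot J ?b w + t\<^sup>2 * W) / 2) =
        k b * std_normal_density (dot J ?b w / s + s * t)"
      by (simp add: k_def std_normal_density_def)
    then show ?thesis
      by (simp only: dens ennreal_mult[OF k_nonneg normal_density_nonneg])
  qed
  \<comment> \<open>Along a line the first argument of \<open>H\<close> may be frozen at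
    \<open>b(i := 0)\<close> by invariance, so that a one-dimensional normal integral is
    left.\<close>
  have step: "(\<integral>\<^sup>+t. (\<Prod>j\<in>J. ennreal (std_normal_density ((b(i := 0)) j + t * w j))) *
        H (\<lambda>j\<in>J. (b(i := 0)) j + t * w j) (dot J (\<lambda>j\<in>J. (b(i := 0)) j + t * w j) w) \<partial>lborel) =
      ennreal (k b) * ennreal (1 / s) * (\<integral>\<^sup>+\<xi>. H (b(i := 0)) (s * \<xi>) \<partial>std_normal_distribution)"
    if b: "b \<in> space (Pi\<^sub>M I (\<lambda>_. lborel))" for b
  proof -
    let ?b = "b(i := 0)"
    have bJ: "?b \<in> extensional J"
      using b by (auto simp: space_PiM PiE_def J_def extensional_def)
    then have bsp: "?b \<in> space (Pi\<^sub>M J (\<lambda>_. lborel))"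
      by (simp add: space_PiM PiE_def)
    have [measurable]: "H ?b \<in> borel_measurable borel"
      using measurable_compose[OF measurable_Pair1'[OF bsp] H[folded J_def]] by simp
    have "H (\<lambda>j\<in>J. ?b j + t * w j) (dot J (\<lambda>j\<in>J. ?b j + t * w j) w) = H ?b (dot J ?b w + t * s\<^sup>2)" for t
      using inv[folded J_def, OF bJ] by (simp only: dot_restrict dot_add_scale_left s W_def)
    then show ?thesis
      using std_normal_affine[OF s(1), of "H ?b" "dot J ?b w"]
      by (simp only: complete_square mult.assoc) (subst nn_integral_cmult, measurable)
  qed
  have "(\<lambda>p. ((fst p)(i := 0), s * snd p)) \<in> measurable (Pi\<^sub>M I (\<lambda>_. lborel) \<Otimes>\<^sub>M std_normal_distribution)
      (Pi\<^sub>M J (\<lambda>_. lborel :: real measure) \<Otimes>\<^sub>M borel)"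
    by (rule measurable_Pair) (use measurable_compose[OF measurable_fst upd_meas] in simp_all)
  from measurable_compose[OF this H[folded J_def]]
  have "(\<lambda>(b, \<xi>). H (b(i := 0)) (s * \<xi>)) \<in> borel_measurable (Pi\<^sub>M I (\<lambda>_. lborel) \<Otimes>\<^sub>M std_normal_distribution)"
    by (simp add: split_beta)
  then have inner_meas: "(\<lambda>b. \<integral>\<^sup>+\<xi>. H (b(i := 0)) (s * \<xi>) \<partial>std_normal_distribution) \<in> borel_measurable (Pi\<^sub>M I (\<lambda>_. lborel))"
    by (rule N.borel_measurable_nn_integral)
  have dens_meas: "(\<lambda>a. \<Prod>j\<in>J. ennreal (std_normal_density (a j))) \<in> borel_measurable (Pi\<^sub>M J (\<lambda>_. lborel))"
    by measurable
  have dot_meas: "(\<lambda>a. dot J a w) \<in> borel_measurable (Pi\<^sub>M J (\<lambda>_. lborel))"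
    using J by measurable
  have H_meas: "(\<lambda>a. H a (dot J a w)) \<in> borel_measurable (Pi\<^sub>M J (\<lambda>_. lborel))"
    using measurable_compose[OF measurable_Pair[OF measurable_ident_sets[OF refl] dot_meas] H[folded J_def]] by simp
  have "(\<integral>\<^sup>+a. H a (dot J a w) \<partial>gauss J) =
      (\<integral>\<^sup>+a. (\<Prod>j\<in>J. ennreal (std_normal_density (a j))) * H a (dot J a w) \<partial>Pi\<^sub>M J (\<lambda>_. lborel))"
    unfolding gauss_def by (rule nn_integral_density[OF dens_meas H_meas])
  also have "\<dots> = ennreal \<bar>w i\<bar> * (\<integral>\<^sup>+b. \<integral>\<^sup>+t. (\<Prod>j\<in>J. ennreal (std_normal_density ((\<lambda>j\<in>J. (b(i := 0)) j + t * w j) j))) *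
        H (\<lambda>j\<in>J. (b(i := 0)) j + t * w j) (dot J (\<lambda>j\<in>J. (b(i := 0)) j + t * w j) w) \<partial>lborel \<partial>Pi\<^sub>M I (\<lambda>_. lborel))"
    by (rule nn_integral_PiM_lborel_fibres[where w = w, OF I wi borel_measurable_times_ennreal[OF dens_meas H_meas, unfolded J_def], folded J_def])
  also have "\<dots> = ennreal \<bar>w i\<bar> * (\<integral>\<^sup>+b. ennreal (k b) * ennreal (1 / s) *
      (\<integral>\<^sup>+\<xi>. H (b(i := 0)) (s * \<xi>) \<partial>std_normal_distribution) \<partial>Pi\<^sub>M I (\<lambda>_. lborel))"
    by (intro arg_cong2[where f = "(*)"] refl nn_integral_cong, subst step[symmetric]) simp_all
  also have "\<dots> = (\<integral>\<^sup>+b. K b * (\<integral>\<^sup>+\<xi>. H (b(i := 0)) (s * \<xi>) \<partial>std_normal_distribution) \<partial>Pi\<^sub>M I (\<lambda>_. lborel))"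
    unfolding K_def mult.assoc
    by (intro nn_integral_cmult[symmetric] borel_measurable_times_ennreal inner_meas) measurable
  finally show "(\<integral>\<^sup>+a. H a (dot (insert i I) a w) \<partial>gauss (insert i I)) =
      (\<integral>\<^sup>+b. K b * (\<integral>\<^sup>+\<xi>. H (b(i := 0)) (sqrt (dot (insert i I) w w) * \<xi>) \<partial>std_normal_distribution)
         \<partial>Pi\<^sub>M I (\<lambda>_. lborel))"
    unfolding J_def s_def W_def .
qed

lemma dot_self_pos_iff:
  assumes "finite I" shows "dot I w w > 0 \<longleftrightarrow> (\<exists>i\<in>I. w i \<noteq> 0)"
proof -
  have "dot I w w \<ge> 0" by (auto simp: dot_def intro: sum_nonneg)
  moreover have "dot I w w = 0 \<longleftrightarrow> (\<forall>i\<in>I. w i = 0)"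
    using assms by (simp add: dot_def sum_nonneg_eq_0_iff)
  ultimately show ?thesis by auto
qed

text \<open>In other words, \<open>dot J a w\<close> is centred Gaussian with variance \<open>dot J w w\<close> and independent of the
  component of \<open>a\<close> orthogonal to \<open>w\<close>, which is all that \<open>H\<close> sees through its first argument.\<close>

lemma nn_integral_gauss_split:
  fixes w :: "'i \<Rightarrow> real"
  assumes J: "finite J" and w: "dot J w w > 0"
    and H [measurable]: "case_prod H \<in> borel_measurable (Pi\<^sub>M J (\<lambda>_. lborel) \<Otimes>\<^sub>M borel)"
    and inv: "\<And>a t y. a \<in> extensional J \<Longrightarrow> H (\<lambda>j\<in>J. a j + t * w j) y = H a y"
  shows "(\<integral>\<^sup>+a. H a (dot J a w) \<partial>gauss J) =
    (\<integral>\<^sup>+a. \<integral>\<^sup>+\<xi>. H a (sqrt (dot J w w) * \<xi>) \<partial>std_normal_distribution \<partial>gauss J)"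
proof -
  interpret N: prob_space std_normal_distribution by (rule prob_space_std_normal)
  obtain i where i: "i \<in> J" "w i \<noteq> 0" using w J dot_self_pos_iff by blast
  define I where "I = J - {i}"
  have I: "finite I" "i \<notin> I" and JI: "J = insert i I" using J i by (auto simp: I_def)
  from nn_integral_gauss_fibres[where I = I and i = i and w = w, OF I i(2)]
  obtain K where K: "\<And>H. case_prod H \<in> borel_measurable (Pi\<^sub>M J (\<lambda>_. lborel) \<Otimes>\<^sub>M borel) \<Longrightarrow>
      (\<And>a t y. a \<in> extensional J \<Longrightarrow> H (\<lambda>j\<in>J. a j + t * w j) y = H a y) \<Longrightarrow>
      (\<integral>\<^sup>+a. H a (dot J a w) \<partial>gauss J) =
      (\<integral>\<^sup>+b. K b * (\<integral>\<^sup>+\<xi>. H (b(i := 0)) (sqrt (dot J w w) * \<xi>) \<partial>std_normal_distribution)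
         \<partial>Pi\<^sub>M I (\<lambda>_. lborel))"
    unfolding JI by this blast
  \<comment> \<open>The kernel never has to be evaluated. \<open>H'\<close> is \<open>H\<close>
    already averaged over its second argument; the disintegration of \<open>H\<close> and that of
    \<open>H'\<close> with the same \<open>K\<close> have equal right-hand sides, which identifies
    the left-hand sides.\<close>
  define H' :: "('i \<Rightarrow> real) \<Rightarrow> real \<Rightarrow> ennreal"
    where "H' a y = (\<integral>\<^sup>+\<xi>. H a (sqrt (dot J w w) * \<xi>) \<partial>std_normal_distribution)" for a y
  have m: "case_prod H' \<in> borel_measurable (Pi\<^sub>M J (\<lambda>_. lborel) \<Otimes>\<^sub>M borel)"
    unfolding H'_def by measurable
  have inv': "H' (\<lambda>j\<in>J. a j + t * w j) y = H' a y" if "a \<in> extensional J" for a t y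
    using that by (simp add: H'_def inv)
  have "(\<integral>\<^sup>+\<xi>. H' a y \<partial>std_normal_distribution) = H' a y" for a y
    by (simp add: N.emeasure_space_1[simplified])
  then show ?thesis
    using K[OF H inv] K[OF m inv'] by (simp add: H'_def)
qed

section \<open>Normal probabilities, null hyperplanes and second moments\<close>

lemma prob_space_gauss:
  assumes "finite I" shows "prob_space (gauss I)"
proof
  have "emeasure (gauss I) (space (gauss I)) =
      (\<integral>\<^sup>+a. (\<Prod>i\<in>I. ennreal (std_normal_density (a i))) \<partial>Pi\<^sub>M I (\<lambda>_. lborel))"
    by (simp add: gauss_def emeasure_density cong: nn_integral_cong)
  also have "\<dots> = (\<Prod>i\<in>I. \<integral>\<^sup>+x. ennreal (std_normal_density x) \<partial>lborel)"
    using assms by (rule lborel_product.product_nn_integral_prod) measurable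
  also have "(\<integral>\<^sup>+x. ennreal (std_normal_density x) \<partial>lborel) = 1"
    using prob_space.emeasure_space_1[OF prob_space_std_normal] by (simp add: emeasure_density)
  finally show "emeasure (gauss I) (space (gauss I)) = 1" by simp
qed

lemma std_normal_atom: "measure std_normal_distribution {x} = 0"
proof -
  have "emeasure std_normal_distribution {x} = 0"
    by (subst emeasure_density) (auto simp: nn_integral_0_iff_AE intro!: AE_I[of _ _ "{x}"] split: split_indicator)
  then show ?thesis by (simp add: measure_def)
qed

lemma std_normal_reflect: "measure std_normal_distribution {..<- y} = measure std_normal_distribution {y<..}"
proof -
  have "emeasure std_normal_distribution {..<- y} =
      (\<integral>\<^sup>+x. ennreal (std_normal_density x) * indicator {..<- y} x \<partial>lborel)"
    by (subst emeasure_density) auto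
  also have "\<dots> = (\<integral>\<^sup>+x. ennreal (std_normal_density x) * indicator {y<..} x \<partial>lborel)"
    by (subst nn_integral_real_affine[where c = "-1" and t = 0])
      (auto simp: normal_density_def indicator_def intro!: nn_integral_cong)
  also have "\<dots> = emeasure std_normal_distribution {y<..}"
    by (subst emeasure_density) auto
  finally show ?thesis by (simp add: measure_def)
qed

lemma std_normal_interval_le:
  assumes "y \<ge> 0"
  shows "measure std_normal_distribution {- y..<y} \<le> y"
proof -
  \<comment> \<open>The density is at most \<open>1 / 2\<close> because
    \<open>2 * pi \<ge> 4\<close>; the interval has length \<open>2 * y\<close>.\<close>
  have "1 / sqrt (2 * pi) \<le> 1 / (2::real)"
    using pi_gt3 by (intro divide_left_mono) (auto intro!: real_le_rsqrt)
  moreover have "exp (- (x\<^sup>2 / 2)) / sqrt (2 * pi) \<le> 1 / sqrt (2 * pi)" for x :: real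
    by (intro divide_right_mono) auto
  ultimately have "std_normal_density x \<le> 1 / 2" for x
    unfolding std_normal_density_def by (metis (no_types) order_trans minus_divide_left times_divide_eq_left mult_1)
  then have "(\<integral>\<^sup>+x. ennreal (std_normal_density x) * indicator {- y..<y} x \<partial>lborel) \<le>
      (\<integral>\<^sup>+x. ennreal (1 / 2) * indicator {- y..<y} x \<partial>lborel)"
    by (intro nn_integral_mono mult_right_mono ennreal_leI) auto
  also have "\<dots> = ennreal y"
    using assms by (subst nn_integral_cmult_indicator) (auto simp: ennreal_mult[symmetric] simp del: ennreal_half)
  finally have "emeasure std_normal_distribution {- y..<y} \<le> ennreal y"
    by (subst emeasure_density) auto
  then show ?thesis
    using assms by (simp add: measure_def enn2real_leI)
qed

text \<open>The event is a half-line starting at \<open>- c / s\<close>. By symmetry of the normal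
  law, twice its probability differs from 1 by the mass of the interval between
  \<open>- \<bar>c\<bar> / s\<close> and \<open>\<bar>c\<bar> / s\<close>.\<close>

lemma std_normal_halfline_bias:
  assumes s: "s > 0"
  shows "\<bar>2 * measure std_normal_distribution {\<xi>. c + s * \<xi> \<ge> 0} - 1\<bar> \<le> \<bar>c\<bar> / s"
proof -
  interpret N: prob_space std_normal_distribution by (rule prob_space_std_normal)
  have atom: "N.prob {y..} = N.prob {y<..}" for y
  proof -
    have "{y..} = {y} \<union> {y<..}" by auto
    moreover have "N.prob ({y} \<union> {y<..}) = N.prob {y} + N.prob {y<..}"
      by (intro N.finite_measure_Union) auto
    ultimately show ?thesis
      by (simp add: std_normal_atom)
  qed
  have nonneg: "2 * N.prob {y..} = 1 - N.prob {- y..<y}" if "y \<ge> 0" for y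
  proof -
    have "UNIV = {..<- y} \<union> ({- y..<y} \<union> {y..})" using that by auto
    then have "1 = N.prob ({..<- y} \<union> ({- y..<y} \<union> {y..}))"
      using N.prob_space by simp
    also have "\<dots> = N.prob {..<- y} + N.prob ({- y..<y} \<union> {y..})"
      using that by (intro N.finite_measure_Union) auto
    also have "N.prob ({- y..<y} \<union> {y..}) = N.prob {- y..<y} + N.prob {y..}"
      by (intro N.finite_measure_Union) auto
    finally show ?thesis using atom[of y] std_normal_reflect[of y] by simp
  qed
  have neg: "N.prob {y..} = 1 - N.prob {- y..}" for y
  proof -
    have "UNIV = {..<y} \<union> {y..}" by auto
    then have "1 = N.prob ({..<y} \<union> {y..})"
      using N.prob_space by simp
    also have "\<dots> = N.prob {..<y} + N.prob {y..}"
      by (intro N.finite_measure_Union) auto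
    finally show ?thesis using atom[of "- y"] std_normal_reflect[of "- y"] by simp
  qed
  have main: "\<bar>2 * N.prob {y..} - 1\<bar> \<le> \<bar>y\<bar>" for y
  proof (cases "y \<ge> 0")
    case True
    then show ?thesis using nonneg[of y] std_normal_interval_le[of y] by simp
  next
    case False
    then show ?thesis using neg[of y] nonneg[of "- y"] std_normal_interval_le[of "- y"] by simp
  qed
  have "{\<xi>. c + s * \<xi> \<ge> 0} = {- c / s..}"
    using s by (auto simp: field_simps)
  then show ?thesis using main[of "- c / s"] s by simp
qed

text \<open>\<open>nn_integral_gauss_split\<close> reduces this to the absence of an atom at 0 in
  dimension one. It will show that almost every \<open>a\<close> is \<open>generic\<close>.\<close>

lemma gauss_dot_AE_nonzero:
  assumes J: "finite J" and v: "dot J v v > 0"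
  shows "AE a in gauss J. dot J a v \<noteq> 0"
proof -
  have [measurable]: "(\<lambda>a. dot J a v) \<in> borel_measurable (Pi\<^sub>M J (\<lambda>_. lborel))"
    using J by measurable
  have "(\<integral>\<^sup>+a. indicator {0} (dot J a v) \<partial>gauss J) =
      (\<integral>\<^sup>+a. \<integral>\<^sup>+\<xi>. indicator {0} (sqrt (dot J v v) * \<xi>) \<partial>std_normal_distribution \<partial>gauss J)"
    using J v by (intro nn_integral_gauss_split) auto
  also have "(\<lambda>\<xi>. indicator {0} (sqrt (dot J v v) * \<xi>) :: ennreal) = indicator {0}"
    using v by (auto simp: indicator_def)
  also have "(\<integral>\<^sup>+\<xi>. indicator {0} \<xi> \<partial>std_normal_distribution) = emeasure std_normal_distribution {0}"
    by (rule nn_integral_indicator) simp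
  also have "emeasure std_normal_distribution {0} = 0"
    using std_normal_atom[of 0] by (simp add: prob_space.prob_eq_0 finite_measure.emeasure_eq_measure prob_space.finite_measure[OF prob_space_std_normal])
  finally have "(\<integral>\<^sup>+a. indicator {0} (dot J a v) \<partial>gauss J) = 0" by simp
  then have "AE a in gauss J. indicator {0::real} (dot J a v) = (0::ennreal)"
    by (subst (asm) nn_integral_0_iff_AE) auto
  then show ?thesis by eventually_elim (auto simp: indicator_def split: if_splits)
qed

lemma gauss_second_moment:
  assumes J: "finite J"
  shows "integrable (gauss J) (\<lambda>a. (dot J a v)\<^sup>2)" "(\<integral>a. (dot J a v)\<^sup>2 \<partial>gauss J) = dot J v v"
proof -
  interpret prob_space "gauss J" using J by (rule prob_space_gauss)
  have [measurable]: "(\<lambda>a. dot J a v) \<in> borel_measurable (Pi\<^sub>M J (\<lambda>_. lborel))"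
    using J by measurable
  have nonneg: "dot J v v \<ge> 0" by (auto simp: dot_def intro: sum_nonneg)
  have *: "(\<integral>\<^sup>+a. ennreal ((dot J a v)\<^sup>2) \<partial>gauss J) = ennreal (dot J v v)"
  proof (cases "dot J v v > 0")
    case True
    have "(\<integral>\<^sup>+a. ennreal ((dot J a v)\<^sup>2) \<partial>gauss J) =
        (\<integral>\<^sup>+a. \<integral>\<^sup>+\<xi>. ennreal ((sqrt (dot J v v) * \<xi>)\<^sup>2) \<partial>std_normal_distribution \<partial>gauss J)"
      using J True by (intro nn_integral_gauss_split) auto
    also have "(\<integral>\<^sup>+\<xi>. ennreal ((sqrt (dot J v v) * \<xi>)\<^sup>2) \<partial>std_normal_distribution) =
        ennreal (dot J v v) * (\<integral>\<^sup>+\<xi>. ennreal (\<xi>\<^sup>2) \<partial>std_normal_distribution)"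
      using nonneg by (subst nn_integral_cmult[symmetric]) (auto simp: ennreal_mult power_mult_distrib)
    also have "(\<integral>\<^sup>+\<xi>. ennreal (\<xi>\<^sup>2) \<partial>std_normal_distribution) = 1"
      using std_normal_distribution_even_moments[of 1]
      by (subst nn_integral_eq_integral) (auto simp: fact_numeral)
    finally show ?thesis by (simp add: emeasure_space_1)
  next
    case False
    then have "v i = 0" if "i \<in> J" for i using J that dot_self_pos_iff by blast
    then have "dot J a v = 0" for a by (auto simp: dot_def)
    then show ?thesis by simp
  qed
  show "integrable (gauss J) (\<lambda>a. (dot J a v)\<^sup>2)"
    using * by (intro integrableI_nonneg) auto
  show "(\<integral>a. (dot J a v)\<^sup>2 \<partial>gauss J) = dot J v v"
    using * nonneg by (subst integral_eq_nn_integral) auto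
qed

section \<open>Conditional bias of a Gaussian sign\<close>

text \<open>Cauchy-Schwarz, read off from the nonnegative quadratic
  \<open>E[1_A (q - l)\<^sup>2]\<close> in \<open>l\<close>.\<close>

lemma (in prob_space) cauchy_schwarz_event:
  assumes A [measurable]: "A \<in> sets M" and q [measurable]: "q \<in> borel_measurable M"
    and bound: "\<And>x. x \<in> space M \<Longrightarrow> \<bar>q x\<bar> \<le> 1"
  shows "(\<integral>x. indicator A x * q x \<partial>M)\<^sup>2 \<le> prob A * (\<integral>x. indicator A x * (q x)\<^sup>2 \<partial>M)"
proof -
  define C where "C = (\<integral>x. indicator A x * q x \<partial>M)"
  define Q where "Q = (\<integral>x. indicator A x * (q x)\<^sup>2 \<partial>M)"
  have int: "integrable M (\<lambda>x. indicator A x * q x)" "integrable M (\<lambda>x. indicator A x * (q x)\<^sup>2)"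
    "integrable M (\<lambda>x. indicator A x :: real)"
    using bound by (auto intro!: integrable_const_bound[where B = 1] simp: indicator_def abs_square_le_1)
  have *: "0 \<le> Q - 2 * l * C + l\<^sup>2 * prob A" for l
  proof -
    have "0 \<le> (\<integral>x. indicator A x * (q x - l)\<^sup>2 \<partial>M)" by simp
    also have "(\<lambda>x. indicator A x * (q x - l)\<^sup>2) =
        (\<lambda>x. indicator A x * (q x)\<^sup>2 - 2 * l * (indicator A x * q x) + l\<^sup>2 * indicator A x)"
      by (auto simp: indicator_def power2_diff)
    finally show ?thesis using int A by (simp add: C_def Q_def)
  qed
  show "C\<^sup>2 \<le> prob A * Q"
  proof (cases "prob A = 0")
    case True
    have "C = 0"
    proof (rule ccontr)
      assume "C \<noteq> 0"
      \<comment> \<open>For \<open>prob A = 0\<close> the quadratic is affine in \<open>l\<close>,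
        and this \<open>l\<close> gives it the value \<open>-1\<close>.\<close>
      then show False using *[of "(Q + 1) / (2 * C)"] True by simp
    qed
    then show ?thesis using True by simp
  next
    case False
    then have "prob A > 0" by (simp add: zero_less_measure_iff)
    with *[of "C / prob A"] show ?thesis
      by (simp add: field_simps power2_eq_square)
  qed
qed

text \<open>Here \<open>u\<close> is the part of a feature vector visible through the past and
  \<open>w\<close> the fresh part. The component of \<open>a\<close> orthogonal to \<open>w\<close>
  decides both \<open>A\<close> and \<open>dot J a u\<close>; given it, \<open>dot J a w\<close> is
  an independent centred normal variable, so the conditional bias \<open>q\<close> of the sign is at
  most \<open>\<bar>dot J a u\<bar>\<close> divided by the length of \<open>w\<close>.
  Cauchy-Schwarz on \<open>A\<close> bounds the squared mean of \<open>q\<close> by a mean of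
  squares.\<close>

lemma gauss_sign_correlation:
  assumes J: "finite J" and A [measurable]: "A \<in> sets (gauss J)"
    and inv: "\<And>a t. a \<in> extensional J \<Longrightarrow> (\<lambda>j\<in>J. a j + t * w j) \<in> A \<longleftrightarrow> a \<in> A"
    and orth: "dot J u w = 0"
    and D: "D = dot J u u + dot J w w" "D > 0"
  shows "(2 * measure (gauss J) {a\<in>A. dot J a (\<lambda>i. u i + w i) \<ge> 0} - measure (gauss J) A)\<^sup>2
    \<le> measure (gauss J) A * (\<integral>a. indicator A a * (2 / D * ((dot J a u)\<^sup>2 + dot J u u)) \<partial>gauss J)"
proof -
  interpret prob_space "gauss J" using J by (rule prob_space_gauss)
  interpret N: prob_space std_normal_distribution by (rule prob_space_std_normal)
  have [measurable]: "(\<lambda>a. dot J a v) \<in> borel_measurable (Pi\<^sub>M J (\<lambda>_. lborel))" for v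
    using J by measurable
  have dot_add: "dot J a (\<lambda>i. u i + w i) = dot J a u + dot J a w" for a
    by (simp add: dot_def sum.distrib algebra_simps)
  have A_ext: "a \<in> extensional J" if "a \<in> A" for a
    using sets.sets_into_space[OF A] that by (auto simp: space_gauss)
  have nonneg: "dot J v v \<ge> 0" for v by (auto simp: dot_def intro: sum_nonneg)
  define B where "B = {a\<in>A. dot J a (\<lambda>i. u i + w i) \<ge> 0}"
  have B_eq: "B = A \<inter> {a\<in>space (gauss J). dot J a u + dot J a w \<ge> 0}"
    using A_ext by (auto simp: B_def dot_add space_gauss)
  have [measurable]: "B \<in> sets (gauss J)"
    unfolding B_eq by measurable
  have "\<exists>q\<in>borel_measurable (gauss J). 2 * prob B - prob A = (\<integral>a. indicator A a * q a \<partial>gauss J) \<and>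
      (\<forall>a. \<bar>q a\<bar> \<le> 1 \<and> (q a)\<^sup>2 \<le> 2 / D * ((dot J a u)\<^sup>2 + dot J u u))"
  \<comment> \<open>The splitting lemma wants positive variance. Without it \<open>w\<close>
    vanishes on \<open>J\<close>, the sign is determined by \<open>dot J a u\<close>, and the
    claimed bound on the square of \<open>q\<close> is at least 1 since then
    \<open>D = dot J u u\<close>.\<close>
  proof (cases "dot J w w > 0")
    case False
    then have w0: "dot J w w = 0" using nonneg[of w] by simp
    define q :: "('a \<Rightarrow> real) \<Rightarrow> real" where "q a = 2 * indicator B a - 1" for a
    have *: "indicator A a * q a = 2 * indicator B a - indicator A a" for a
      by (auto simp: q_def B_def indicator_def)
    show ?thesis
    proof (intro bexI[of _ q] conjI allI)
      show "2 * prob B - prob A = (\<integral>a. indicator A a * q a \<partial>gauss J)"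
      proof -
        have "integrable (gauss J) (\<lambda>a. indicator B a :: real)" "integrable (gauss J) (\<lambda>a. indicator A a :: real)"
          by (auto intro!: integrable_const_bound[where B = 1] simp: indicator_def)
        then show ?thesis unfolding * by simp
      qed
      fix a
      show "\<bar>q a\<bar> \<le> 1" by (simp add: q_def indicator_def)
      have "(q a)\<^sup>2 \<le> 2 / D * (0 + D)"
        using D(2) by (simp add: q_def indicator_def)
      also have "\<dots> \<le> 2 / D * ((dot J a u)\<^sup>2 + dot J u u)"
        using D w0 by (intro mult_left_mono add_mono) auto
      finally show "(q a)\<^sup>2 \<le> 2 / D * ((dot J a u)\<^sup>2 + dot J u u)" .
    next
      show "q \<in> borel_measurable (gauss J)" unfolding q_def by measurable
    qed
  next
    case True
    define s where "s = sqrt (dot J w w)"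
    have s: "s > 0" "s\<^sup>2 = dot J w w" using True by (auto simp: s_def)
    define p where "p a = N.prob {\<xi>. dot J a u + s * \<xi> \<ge> 0}" for a
    define H :: "('a \<Rightarrow> real) \<Rightarrow> real \<Rightarrow> ennreal"
      where "H a y = indicator A a * indicator {0..} (dot J a u + y)" for a y
    have H_meas: "case_prod H \<in> borel_measurable (Pi\<^sub>M J (\<lambda>_. lborel) \<Otimes>\<^sub>M borel)"
    proof -
      have [measurable]: "A \<in> sets (Pi\<^sub>M J (\<lambda>_. lborel))" using A by (simp add: sets_gauss)
      have "(\<lambda>p. indicator A (fst p) * indicator {0..} (dot J (fst p) u + snd p) :: ennreal)
          \<in> borel_measurable (Pi\<^sub>M J (\<lambda>_. lborel) \<Otimes>\<^sub>M borel)"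
        by measurable
      then show ?thesis by (simp add: H_def split_beta')
    qed
    have H_inv: "H (\<lambda>j\<in>J. a j + t * w j) y = H a y" if "a \<in> extensional J" for a t y
      using inv[OF that, of t] orth
      by (auto simp: H_def indicator_def dot_add_scale_left dot_commute[of _ w u])
    have inner: "(\<integral>\<^sup>+\<xi>. H a (s * \<xi>) \<partial>std_normal_distribution) = ennreal (indicator A a * p a)" for a
    proof -
      have "(\<integral>\<^sup>+\<xi>. H a (s * \<xi>) \<partial>std_normal_distribution) =
          (\<integral>\<^sup>+\<xi>. indicator A a * indicator {\<xi>. dot J a u + s * \<xi> \<ge> 0} \<xi> \<partial>std_normal_distribution)"
        by (intro nn_integral_cong) (auto simp: H_def indicator_def)
      also have "\<dots> = indicator A a * emeasure std_normal_distribution {\<xi>. dot J a u + s * \<xi> \<ge> 0}"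
        by (subst nn_integral_cmult_indicator) auto
      finally show ?thesis
        by (simp add: p_def N.emeasure_eq_measure indicator_def)
    qed
    have [measurable]: "p \<in> borel_measurable (gauss J)"
    proof -
      have "p = (\<lambda>a. enn2real (\<integral>\<^sup>+\<xi>. indicator {0..} (dot J a u + s * \<xi>) \<partial>std_normal_distribution))"
      proof
        fix a
        have "(\<integral>\<^sup>+\<xi>. indicator {0..} (dot J a u + s * \<xi>) \<partial>std_normal_distribution) =
            (\<integral>\<^sup>+\<xi>. indicator {\<xi>. dot J a u + s * \<xi> \<ge> 0} \<xi> \<partial>std_normal_distribution)"
          by (intro nn_integral_cong) (auto simp: indicator_def)
        also have "\<dots> = emeasure std_normal_distribution {\<xi>. dot J a u + s * \<xi> \<ge> 0}"
          by (intro nn_integral_indicator) auto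
        finally show "p a = enn2real (\<integral>\<^sup>+\<xi>. indicator {0..} (dot J a u + s * \<xi>) \<partial>std_normal_distribution)"
          by (simp add: p_def measure_def)
      qed
      also have "\<dots> \<in> borel_measurable (gauss J)"
        by measurable
      finally show ?thesis .
    qed
    have p_bounds: "0 \<le> p a" "p a \<le> 1" for a
      by (auto simp: p_def)
    have int: "integrable (gauss J) (\<lambda>a. indicator A a * p a)" "integrable (gauss J) (\<lambda>a. indicator A a :: real)"
      using p_bounds by (auto intro!: integrable_const_bound[where B = 1] simp: indicator_def)
    have "emeasure (gauss J) B = (\<integral>\<^sup>+a. indicator B a \<partial>gauss J)"
      by simp
    also have "\<dots> = (\<integral>\<^sup>+a. H a (dot J a w) \<partial>gauss J)"
      by (intro nn_integral_cong) (auto simp: H_def B_def dot_add indicator_def)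
    also have "\<dots> = (\<integral>\<^sup>+a. ennreal (indicator A a * p a) \<partial>gauss J)"
      using nn_integral_gauss_split[OF J True H_meas H_inv] inner by (simp add: s_def)
    also have "\<dots> = ennreal (\<integral>a. indicator A a * p a \<partial>gauss J)"
      using p_bounds by (intro nn_integral_eq_integral int) auto
    finally have B: "prob B = (\<integral>a. indicator A a * p a \<partial>gauss J)"
      using p_bounds by (simp add: measure_def integral_nonneg_AE)
    show ?thesis
    proof (intro bexI[of _ "\<lambda>a. 2 * p a - 1"] conjI allI)
      have "(\<integral>a. indicator A a * (2 * p a - 1) \<partial>gauss J) =
          (\<integral>a. 2 * (indicator A a * p a) - indicator A a \<partial>gauss J)"
        by (intro Bochner_Integration.integral_cong) (auto simp: indicator_def)
      also have "\<dots> = 2 * prob B - prob A"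
        using int A by (simp add: B)
      finally show "2 * prob B - prob A = (\<integral>a. indicator A a * (2 * p a - 1) \<partial>gauss J)" ..
      fix a
      show le1: "\<bar>2 * p a - 1\<bar> \<le> 1" using p_bounds[of a] by (simp add: abs_le_iff)
      show "(2 * p a - 1)\<^sup>2 \<le> 2 / D * ((dot J a u)\<^sup>2 + dot J u u)"
      \<comment> \<open>Either the fresh part carries half of \<open>D\<close> and the half-line
        bias applies with variance at least \<open>D / 2\<close>, or \<open>dot J u u\<close>
        exceeds \<open>D / 2\<close> and the right side is at least 1. The summand
        \<open>dot J u u\<close> is there for the second case.\<close>
      proof (cases "dot J w w \<ge> D / 2")
        case True
        have "\<bar>2 * p a - 1\<bar> \<le> \<bar>dot J a u\<bar> / s"
          unfolding p_def by (rule std_normal_halfline_bias[OF s(1)])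
        then have "\<bar>2 * p a - 1\<bar>\<^sup>2 \<le> (\<bar>dot J a u\<bar> / s)\<^sup>2"
          by (intro power_mono) auto
        also have "\<dots> = (dot J a u)\<^sup>2 / dot J w w"
          using s by (simp add: power_divide)
        also have "\<dots> \<le> (dot J a u)\<^sup>2 / (D / 2)"
          using True D(2) by (intro divide_left_mono) auto
        also have "\<dots> \<le> 2 / D * ((dot J a u)\<^sup>2 + dot J u u)"
          using nonneg[of u] D(2) by (simp add: field_simps)
        finally show ?thesis by simp
      next
        case False
        have "(2 * p a - 1)\<^sup>2 \<le> 2 / D * (0 + D / 2)"
          using le1 D(2) by (simp add: abs_square_le_1)
        also have "\<dots> \<le> 2 / D * ((dot J a u)\<^sup>2 + dot J u u)"
          using D False by (intro mult_left_mono add_mono) auto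
        finally show ?thesis .
      qed
    qed measurable
  qed
  then obtain q where [measurable]: "q \<in> borel_measurable (gauss J)"
    and q: "2 * prob B - prob A = (\<integral>a. indicator A a * q a \<partial>gauss J)"
      "\<And>a. \<bar>q a\<bar> \<le> 1" "\<And>a. (q a)\<^sup>2 \<le> 2 / D * ((dot J a u)\<^sup>2 + dot J u u)" by blast
  have "(2 * prob B - prob A)\<^sup>2 \<le> prob A * (\<integral>a. indicator A a * (q a)\<^sup>2 \<partial>gauss J)"
    unfolding q(1) using q(2) by (intro cauchy_schwarz_event) auto
  also have "(\<integral>a. indicator A a * (q a)\<^sup>2 \<partial>gauss J) \<le>
      (\<integral>a. indicator A a * (2 / D * ((dot J a u)\<^sup>2 + dot J u u)) \<partial>gauss J)"
  proof (rule integral_mono)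
    show "integrable (gauss J) (\<lambda>a. indicator A a * (q a)\<^sup>2)"
      using q(2) by (auto intro!: integrable_const_bound[where B = 1] simp: indicator_def abs_square_le_1)
    show "integrable (gauss J) (\<lambda>a. indicator A a * (2 / D * ((dot J a u)\<^sup>2 + dot J u u)))"
      using gauss_second_moment(1)[OF J, of u]
      by (intro integrable_real_mult_indicator[unfolded mult.commute[of _ "indicator _ _"]]) auto
    show "indicator A a * (q a)\<^sup>2 \<le> indicator A a * (2 / D * ((dot J a u)\<^sup>2 + dot J u u))" for a
      using q(3) by (intro mult_left_mono) auto
  qed
  finally show ?thesis by (simp add: B_def mult_left_mono)
qed

subsection \<open>Random halfspaces in an isotropic feature space\<close>

definition orthonormal_basis_for :: "'i set \<Rightarrow> ('i \<Rightarrow> real) set \<Rightarrow> ('i \<Rightarrow> real) set \<Rightarrow> bool" where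
  "orthonormal_basis_for J E V \<longleftrightarrow> finite E \<and>
     (\<forall>e\<in>E. \<forall>e'\<in>E. dot J e e' = of_bool (e = e')) \<and>
     (\<forall>v\<in>V. \<forall>i\<in>J. v i = (\<Sum>e\<in>E. dot J v e * e i))"

lemma dot_sum_left: "dot J (\<lambda>i. \<Sum>e\<in>E. c e * e i) v = (\<Sum>e\<in>E. c e * dot J e v)"
  unfolding dot_def by (simp add: sum_distrib_right sum_distrib_left mult.assoc) (rule sum.swap)

lemma dot_diff_left: "dot J (\<lambda>i. u i - v i) w = dot J u w - dot J v w"
  by (simp add: dot_def sum_subtractf algebra_simps)

lemma dot_divide_left: "dot J (\<lambda>i. u i / c) v = dot J u v / c"
  by (simp add: dot_def sum_divide_distrib)

lemma dot_cong: "(\<And>i. i \<in> J \<Longrightarrow> u i = u' i) \<Longrightarrow> (\<And>i. i \<in> J \<Longrightarrow> v i = v' i) \<Longrightarrow> dot J u v = dot J u' v'"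
  by (simp add: dot_def)

lemma orthonormal_projection:
  assumes "finite E" "\<forall>e\<in>E. \<forall>e'\<in>E. dot J e e' = of_bool (e = e')" "e \<in> E"
  shows "dot J (\<lambda>i. \<Sum>e\<in>E. c e * e i) e = c e"
proof -
  have "(\<Sum>f\<in>E. c f * dot J f e) = (\<Sum>f\<in>E. if f = e then c f else 0)"
    using assms by (intro sum.cong) auto
  then show ?thesis using assms by (simp add: dot_sum_left)
qed

text \<open>Gram-Schmidt: if the residual \<open>r\<close> of the new vector vanishes on
  \<open>J\<close>, the old basis still serves; otherwise \<open>r\<close> is normalised and
  added.\<close>

lemma orthonormal_basis_exists:
  assumes J: "finite J" and "finite V"
  shows "\<exists>E. orthonormal_basis_for J E V \<and> card E \<le> card V"
  using assms(2)
proof (induction V)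
  case empty
  then show ?case by (intro exI[of _ "{}"]) (simp add: orthonormal_basis_for_def)
next
  case (insert v V)
  then obtain E where basis: "orthonormal_basis_for J E V" and card: "card E \<le> card V"
    by blast
  have E: "finite E" "\<forall>e\<in>E. \<forall>e'\<in>E. dot J e e' = of_bool (e = e')"
    using basis unfolding orthonormal_basis_for_def by blast+
  have EV: "v i = (\<Sum>e\<in>E. dot J v e * e i)" if "v \<in> V" "i \<in> J" for v i
    using basis that unfolding orthonormal_basis_for_def by blast
  define p where "p = (\<lambda>i. \<Sum>e\<in>E. dot J v e * e i)"
  define r where "r = (\<lambda>i. v i - p i)"
  have re: "dot J r e = 0" if "e \<in> E" for e
    using orthonormal_projection[OF E(1,2) that, of "dot J v"] by (simp add: r_def p_def dot_diff_left)
  show ?case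
  proof (cases "dot J r r > 0")
    case False
    then have "v i = p i" if "i \<in> J" for i
      using dot_self_pos_iff[OF J, of r] that by (auto simp: r_def)
    then have "orthonormal_basis_for J E (insert v V)"
      using basis unfolding orthonormal_basis_for_def p_def by blast
    then show ?thesis
      using card insert.hyps by (intro exI[of _ E]) auto
  next
    case True
    define s where "s = sqrt (dot J r r)"
    have s: "s > 0" "s * s = dot J r r" using True by (auto simp: s_def)
    define e0 where "e0 = (\<lambda>i. r i / s)"
    have e0e: "dot J e0 e = 0" "dot J e e0 = 0" if "e \<in> E" for e
      using re[OF that] dot_commute[of J e e0] by (simp_all add: e0_def dot_divide_left)
    have e0r: "dot J r e0 = s"
    proof -
      have "dot J r e0 = dot J r r / s"
        unfolding dot_commute[of J r e0] by (simp add: e0_def dot_divide_left)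
      also have "\<dots> = s" using s by (metis nonzero_mult_div_cancel_left less_irrefl)
      finally show ?thesis .
    qed
    have e00: "dot J e0 e0 = 1"
      using e0r s(1) by (simp add: e0_def dot_divide_left)
    have new: "e0 \<notin> E" using e0e e00 by force
    have dv: "dot J v e0 = s"
    proof -
      have "dot J v e0 = dot J r e0 + dot J p e0"
        by (simp add: r_def dot_diff_left)
      also have "dot J p e0 = 0" using e0e by (simp add: p_def dot_sum_left)
      finally show ?thesis using e0r by simp
    qed
    \<comment> \<open>Vectors already expanded in \<open>E\<close> are orthogonal to
      \<open>e0\<close>, so their expansions acquire a zero coefficient.\<close>
    have dV: "dot J u e0 = 0" if "u \<in> V" for u
    proof -
      have "dot J u e0 = dot J (\<lambda>i. \<Sum>e\<in>E. dot J u e * e i) e0"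
        using EV[OF that] by (intro dot_cong) simp_all
      then show ?thesis using e0e by (simp add: dot_sum_left)
    qed
    have "orthonormal_basis_for J (insert e0 E) (insert v V)"
      unfolding orthonormal_basis_for_def
    proof (intro conjI ballI)
      fix u i assume u: "u \<in> insert v V" and i: "i \<in> J"
      show "u i = (\<Sum>e\<in>insert e0 E. dot J u e * e i)"
      proof (cases "u \<in> V")
        case True
        then show ?thesis using E(1) EV[OF True i] new dV[OF True] by simp
      next
        case False
        then have "u = v" using u by simp
        then show ?thesis using E(1) new dv s(1) by (simp add: e0_def r_def p_def)
      qed
    qed (use E e0e e00 new in auto)
    then show ?thesis
      using E card insert.hyps new by (intro exI[of _ "insert e0 E"]) auto
  qed
qed

section \<open>Convexity bounds for \<open>x ln x\<close>, and sums over sample lists\<close>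

text \<open>From \<open>ln y \<le> y - 1\<close> at \<open>y = K' / K\<close>. The linear term will
  cancel on averaging over a new sample, which leaves the chi-square term
  \<open>(K' - K)\<^sup>2 / K\<close>.\<close>

lemma xlnx_add_le:
  fixes K K' :: real
  assumes "K > 0" "K' \<ge> 0"
  shows "K' * ln K' \<le> K * ln K + (K' - K) * (1 + ln K) + (K' - K)\<^sup>2 / K"
proof (cases "K' = 0")
  case True
  then show ?thesis using assms by (simp add: field_simps power2_eq_square)
next
  case False
  have "ln (K' / K) \<le> K' / K - 1"
    using assms False by (intro ln_le_minus_one) auto
  then have "K' * ln (K' / K) \<le> K' * (K' / K - 1)"
    using assms by (intro mult_left_mono) auto
  moreover have "K' * ln (K' / K) = K' * ln K' - K' * ln K"
    using assms False by (simp add: ln_div algebra_simps)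
  moreover have "K' * (K' / K - 1) = (K' - K) + (K' - K)\<^sup>2 / K"
    using assms by (simp add: field_simps power2_eq_square)
  ultimately show ?thesis by (simp add: algebra_simps)
qed

text \<open>Tangents of a convex function at \<open>1\<close> and \<open>exp 1\<close>. Their slopes
  1 and 2 differ by 1, so mixing them with weights \<open>1 - t\<close> and \<open>t\<close> brings
  out a term \<open>t * y\<close>.\<close>

lemma xlnx_ge_tangent:
  fixes y :: real
  assumes "y \<ge> 0"
  shows "y * ln y \<ge> y - 1" "y * ln y \<ge> 2 * y - exp 1"
proof -
  have *: "y * ln y \<ge> y * (1 + ln c) - c" if c: "c > 0" for c :: real
  proof (cases "y = 0")
    case False
    then have "ln (c / y) \<le> c / y - 1"
      using assms c by (intro ln_le_minus_one) auto
    then have "y * ln (c / y) \<le> y * (c / y - 1)"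
      using assms by (intro mult_left_mono) auto
    then show ?thesis using False assms c by (simp add: ln_div algebra_simps)
  qed (use c in simp)
  show "y * ln y \<ge> y - 1" using *[of 1] by simp
  show "y * ln y \<ge> 2 * y - exp 1" using *[of "exp 1"] by simp
qed

abbreviation samples :: "'x set \<Rightarrow> nat \<Rightarrow> 'x list set" where
  "samples X m \<equiv> {xs. set xs \<subseteq> X \<and> length xs = m}"

text \<open>The newest sample stands at the head, so the tail \<open>xs\<close> is the past of
  \<open>x\<close>.\<close>

lemma sum_samples_Suc:
  "(\<Sum>xs\<in>samples X (Suc m). F xs) = (\<Sum>xs\<in>samples X m. \<Sum>x\<in>X. F (x # xs))"
proof -
  have "samples X (Suc m) = (\<lambda>(xs, x). x # xs) ` (samples X m \<times> X)"
    by (auto simp: length_Suc_conv image_iff)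
  moreover have "inj_on (\<lambda>(xs, x). x # xs) (samples X m \<times> X)"
    by (auto simp: inj_on_def)
  ultimately have "(\<Sum>xs\<in>samples X (Suc m). F xs) = (\<Sum>(xs, x)\<in>samples X m \<times> X. F (x # xs))"
    by (simp add: sum.reindex case_prod_unfold)
  then show ?thesis by (simp add: sum.cartesian_product)
qed

text \<open>\<open>isotropic\<close> says that the features have identity second-moment matrix under
  the uniform law on \<open>X\<close>; \<open>flip\<close> is a symmetry that carries each halfspace
  to its negative. On the hypercube the features will be monomials and \<open>flip\<close> a change
  of signs.\<close>

locale isotropic_features =
  fixes X :: "'x set" and J :: "'i set" and \<phi> :: "'x \<Rightarrow> 'i \<Rightarrow> real" and flip :: "'x \<Rightarrow> 'x"
  assumes finite_X: "finite X" and X_nonempty: "X \<noteq> {}"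
    and finite_J: "finite J" and J_nonempty: "J \<noteq> {}"
    and isotropic: "\<And>S T. S \<in> J \<Longrightarrow> T \<in> J \<Longrightarrow> (\<Sum>x\<in>X. \<phi> x S * \<phi> x T) = (if S = T then real (card X) else 0)"
    and norm_features: "\<And>x. x \<in> X \<Longrightarrow> dot J (\<phi> x) (\<phi> x) = real (card J)"
    and flip_bij: "bij_betw flip X X"
    and features_flip: "\<And>x S. x \<in> X \<Longrightarrow> S \<in> J \<Longrightarrow> \<phi> (flip x) S = - \<phi> x S"
begin

sublocale gauss: prob_space "gauss J"
  by (rule prob_space_gauss[OF finite_J])

lemma measurable_dot_J [measurable]: "(\<lambda>a. dot J a v) \<in> borel_measurable (Pi\<^sub>M J (\<lambda>_. lborel))"
  by (rule measurable_dot[OF finite_J])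

lemma card_X_pos: "card X > 0" and card_J_pos: "card J > 0"
  using finite_X X_nonempty finite_J J_nonempty by (auto simp: card_gt_0_iff)

lemma sum_dot_features: "(\<Sum>x\<in>X. dot J (\<phi> x) u * dot J (\<phi> x) v) = real (card X) * dot J u v"
proof -
  have "(\<Sum>x\<in>X. dot J (\<phi> x) u * dot J (\<phi> x) v) =
      (\<Sum>x\<in>X. \<Sum>S\<in>J. \<Sum>T\<in>J. u S * v T * (\<phi> x S * \<phi> x T))"
    by (simp add: dot_def sum_product mult_ac)
  also have "\<dots> = (\<Sum>S\<in>J. \<Sum>T\<in>J. u S * v T * (\<Sum>x\<in>X. \<phi> x S * \<phi> x T))"
    by (subst sum.swap, intro sum.cong refl, subst sum.swap) (simp add: sum_distrib_left)
  also have "\<dots> = (\<Sum>S\<in>J. \<Sum>T\<in>J. if S = T then u S * v T * real (card X) else 0)"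
    by (intro sum.cong refl) (simp add: isotropic)
  also have "\<dots> = (\<Sum>S\<in>J. u S * v S * real (card X))"
    using finite_J by simp
  finally show ?thesis by (simp add: dot_def sum_distrib_left mult_ac)
qed

section \<open>Halfspaces that contain exactly half of the sample space\<close>

text \<open>No sample lies on the bounding hyperplane, so \<open>flip\<close> maps the halfspace
  within \<open>X\<close> exactly onto its complement.\<close>

definition generic :: "('i \<Rightarrow> real) \<Rightarrow> bool" where
  "generic a \<longleftrightarrow> (\<forall>x\<in>X. dot J a (\<phi> x) \<noteq> 0)"

lemma AE_generic: "AE a in gauss J. generic a"
  unfolding generic_def
  by (intro AE_finite_allI finite_X gauss_dot_AE_nonzero finite_J) (use norm_features card_J_pos in auto)

text \<open>Reindexing by \<open>flip\<close> replaces the indicator of the halfspace by that of its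
  complement and keeps \<open>g\<close>, so the halfspace carries half of the sum.\<close>

lemma sum_half:
  assumes a: "generic a" and g: "\<And>x. x \<in> X \<Longrightarrow> g (flip x) = (g x :: real)"
  shows "(\<Sum>x\<in>X. 2 * of_bool (dot J a (\<phi> x) \<ge> 0) * g x) = (\<Sum>x\<in>X. g x)"
proof -
  have neg: "dot J a (\<phi> (flip x)) = - dot J a (\<phi> x)" if "x \<in> X" for x
    using features_flip[OF that] by (simp add: dot_def sum_negf)
  have "(\<Sum>x\<in>X. of_bool (dot J a (\<phi> x) \<ge> 0) * g x) = (\<Sum>x\<in>X. of_bool (dot J a (\<phi> (flip x)) \<ge> 0) * g (flip x))"
    by (rule sum.reindex_bij_betw[OF flip_bij, symmetric])
  also have "\<dots> = (\<Sum>x\<in>X. (1 - of_bool (dot J a (\<phi> x) \<ge> 0)) * g x)"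
    using a by (intro sum.cong) (auto simp: neg g generic_def)
  also have "\<dots> = (\<Sum>x\<in>X. g x) - (\<Sum>x\<in>X. of_bool (dot J a (\<phi> x) \<ge> 0) * g x)"
    by (simp add: left_diff_distrib sum_subtractf)
  finally show ?thesis by (simp add: sum_distrib_left[symmetric] mult.assoc)
qed

text \<open>The factors 2 and the indicators are removed one sample at a time with
  \<open>sum_half\<close>. A flip-invariant statistic thus has the same average over samples from a
  halfspace as over samples from all of \<open>X\<close>.\<close>

lemma sum_samples_flip_invariant:
  assumes a: "generic a"
    and F: "\<And>ys x zs. x \<in> X \<Longrightarrow> F (ys @ flip x # zs) = (F (ys @ x # zs) :: real)"
  shows "(\<Sum>xs\<in>samples X k. 2 ^ k * of_bool (\<forall>x\<in>set xs. dot J a (\<phi> x) \<ge> 0) * F xs) = (\<Sum>xs\<in>samples X k. F xs)"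
  using F
proof (induction k arbitrary: F)
  case 0
  have "samples X 0 = {[]}" by auto
  then show ?case by simp
next
  case (Suc k)
  have IH: "(\<Sum>xs\<in>samples X k. 2 ^ k * of_bool (\<forall>x\<in>set xs. dot J a (\<phi> x) \<ge> 0) * F (x # xs)) =
      (\<Sum>xs\<in>samples X k. F (x # xs))" for x
    using Suc.prems[of _ "x # _"] by (intro Suc.IH) simp
  have "(\<Sum>xs\<in>samples X (Suc k). 2 ^ Suc k * of_bool (\<forall>x\<in>set xs. dot J a (\<phi> x) \<ge> 0) * F xs) =
      (\<Sum>x\<in>X. \<Sum>xs\<in>samples X k. 2 * of_bool (dot J a (\<phi> x) \<ge> 0) *
         (2 ^ k * of_bool (\<forall>x\<in>set xs. dot J a (\<phi> x) \<ge> 0) * F (x # xs)))"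
    unfolding sum_samples_Suc by (subst sum.swap) (intro sum.cong refl, auto)
  also have "\<dots> = (\<Sum>x\<in>X. 2 * of_bool (dot J a (\<phi> x) \<ge> 0) * (\<Sum>xs\<in>samples X k. F (x # xs)))"
    by (simp only: sum_distrib_left[symmetric] IH)
  also have "\<dots> = (\<Sum>x\<in>X. \<Sum>xs\<in>samples X k. F (x # xs))"
    using Suc.prems[of _ "[]"] by (intro sum_half a) simp
  also have "\<dots> = (\<Sum>xs\<in>samples X (Suc k). F xs)"
    unfolding sum_samples_Suc by (rule sum.swap)
  finally show ?case .
qed

section \<open>The likelihood ratio and the energy of past samples\<close>

text \<open>The directions whose halfspace contains all samples seen so far;
  \<open>extensional J\<close> is the space of \<open>gauss J\<close>.\<close>

definition cone :: "'x list \<Rightarrow> ('i \<Rightarrow> real) set" where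
  "cone xs = {a \<in> extensional J. \<forall>x\<in>set xs. dot J a (\<phi> x) \<ge> 0}"

text \<open>The likelihood ratio, against i.i.d. uniform samples, of samples drawn from a random
  halfspace of the feature space.\<close>

definition lratio :: "'x list \<Rightarrow> real" where
  "lratio xs = 2 ^ length xs * gauss.prob (cone xs)"

lemma cone_sets [measurable]: "cone xs \<in> sets (gauss J)"
proof -
  have "cone xs = {a\<in>space (gauss J). \<forall>x\<in>set xs. dot J a (\<phi> x) \<ge> 0}"
    by (auto simp: cone_def space_gauss)
  also have "\<dots> \<in> sets (gauss J)" by measurable
  finally show ?thesis .
qed

lemma lratio_nonneg: "lratio xs \<ge> 0"
  by (simp add: lratio_def)

lemma prob_cone: "gauss.prob (cone xs) = (\<integral>a. of_bool (\<forall>x\<in>set xs. dot J a (\<phi> x) \<ge> 0) \<partial>gauss J)"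
proof -
  have "gauss.prob (cone xs) = (\<integral>a. indicator (cone xs) a \<partial>gauss J)"
    by simp
  also have "\<dots> = (\<integral>a. of_bool (\<forall>x\<in>set xs. dot J a (\<phi> x) \<ge> 0) \<partial>gauss J)"
    by (intro Bochner_Integration.integral_cong refl) (auto simp: cone_def space_gauss indicator_def)
  finally show ?thesis .
qed

lemma integrable_cone: "integrable (gauss J) (\<lambda>a. of_bool (\<forall>x\<in>set xs. dot J a (\<phi> x) \<ge> 0) :: real)"
  by (rule gauss.integrable_const_bound[where B = 1]) (auto simp: sets_gauss)

text \<open>Martingale property of the likelihood ratio: for almost every \<open>a\<close> half of
  \<open>X\<close> lies in the halfspace, which the additional factor 2 compensates.\<close>

lemma sum_lratio_Cons: "(\<Sum>x\<in>X. lratio (x # xs)) = real (card X) * lratio xs"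
proof -
  have "(\<Sum>x\<in>X. lratio (x # xs)) =
      (\<integral>a. (\<Sum>x\<in>X. 2 ^ Suc (length xs) * of_bool (\<forall>y\<in>set (x # xs). dot J a (\<phi> y) \<ge> 0)) \<partial>gauss J)"
    unfolding lratio_def prob_cone
    by (subst Bochner_Integration.integral_sum) (auto intro!: integrable_mult_right integrable_cone simp del: set_simps)
  also have "\<dots> = (\<integral>a. 2 ^ length xs * real (card X) * of_bool (\<forall>y\<in>set xs. dot J a (\<phi> y) \<ge> 0) \<partial>gauss J)"
  proof (rule integral_cong_AE)
    show "AE a in gauss J. (\<Sum>x\<in>X. 2 ^ Suc (length xs) * of_bool (\<forall>y\<in>set (x # xs). dot J a (\<phi> y) \<ge> 0)) =
        2 ^ length xs * real (card X) * of_bool (\<forall>y\<in>set xs. dot J a (\<phi> y) \<ge> 0)"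
      using AE_generic
    proof eventually_elim
      case (elim a)
      have "(\<Sum>x\<in>X. 2 ^ Suc (length xs) * of_bool (\<forall>y\<in>set (x # xs). dot J a (\<phi> y) \<ge> 0)) =
          (\<Sum>x\<in>X. 2 * of_bool (dot J a (\<phi> x) \<ge> 0) * (2 ^ length xs * of_bool (\<forall>y\<in>set xs. dot J a (\<phi> y) \<ge> 0) :: real))"
        by (intro sum.cong) auto
      also have "\<dots> = (\<Sum>x\<in>X. 2 ^ length xs * of_bool (\<forall>y\<in>set xs. dot J a (\<phi> y) \<ge> 0))"
        by (intro sum_half elim) simp
      finally show ?case by simp
    qed
  qed (use sets_gauss in measurable)
  also have "\<dots> = real (card X) * lratio xs"
    using integrable_cone[of xs] by (simp add: lratio_def prob_cone)
  finally show ?thesis .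
qed

lemma sum_lratio: "(\<Sum>xs\<in>samples X m. lratio xs) = real (card X) ^ m"
proof (induction m)
  case 0
  have "samples X 0 = {[]}" by auto
  moreover have "cone [] = space (gauss J)" by (simp add: cone_def space_gauss)
  ultimately show ?case using gauss.prob_space by (simp add: lratio_def)
next
  case (Suc m)
  then show ?case by (simp add: sum_samples_Suc sum_lratio_Cons sum_distrib_left[symmetric])
qed

text \<open>Negating features in \<open>xs\<close> does not change the predicate under \<open>SOME\<close>, hence not the chosen
  basis either.\<close>

definition basis :: "'x list \<Rightarrow> ('i \<Rightarrow> real) set" where
  "basis xs = (SOME E. orthonormal_basis_for J E (\<phi> ` set xs) \<and> card E \<le> length xs)"

lemma basis: "orthonormal_basis_for J (basis xs) (\<phi> ` set xs)" "card (basis xs) \<le> length xs"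
proof -
  obtain E where "orthonormal_basis_for J E (\<phi> ` set xs)" "card E \<le> card (\<phi> ` set xs)"
    using orthonormal_basis_exists[OF finite_J, of "\<phi> ` set xs"] by auto
  moreover have "card (\<phi> ` set xs) \<le> length xs"
    using card_image_le[of "set xs" \<phi>] card_length[of xs] by simp
  ultimately have "\<exists>E. orthonormal_basis_for J E (\<phi> ` set xs) \<and> card E \<le> length xs"
    using order_trans by blast
  from someI_ex[OF this] show "orthonormal_basis_for J (basis xs) (\<phi> ` set xs)" "card (basis xs) \<le> length xs"
    by (auto simp: basis_def)
qed

lemma basis_flip:
  assumes "x \<in> X"
  shows "basis (ys @ flip x # zs) = basis (ys @ x # zs)"
proof -
  have "dot J (\<phi> (flip x)) e = - dot J (\<phi> x) e" for e
    using features_flip[OF assms] by (simp add: dot_def sum_negf)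
  then have "(\<forall>i\<in>J. \<phi> (flip x) i = (\<Sum>e\<in>E. dot J (\<phi> (flip x)) e * e i)) \<longleftrightarrow>
      (\<forall>i\<in>J. \<phi> x i = (\<Sum>e\<in>E. dot J (\<phi> x) e * e i))" for E
    using features_flip[OF assms] by (simp add: sum_negf)
  then have "(\<forall>v\<in>\<phi> ` set (ys @ flip x # zs). \<forall>i\<in>J. v i = (\<Sum>e\<in>E. dot J v e * e i)) \<longleftrightarrow>
      (\<forall>v\<in>\<phi> ` set (ys @ x # zs). \<forall>i\<in>J. v i = (\<Sum>e\<in>E. dot J v e * e i))" for E
    unfolding set_append list.set image_Un image_insert by blast
  then have "orthonormal_basis_for J E (\<phi> ` set (ys @ flip x # zs)) \<longleftrightarrow>
      orthonormal_basis_for J E (\<phi> ` set (ys @ x # zs))" for E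
    unfolding orthonormal_basis_for_def by simp
  then show ?thesis by (simp add: basis_def)
qed

text \<open>The squared length of the projection of \<open>a\<close> to the span of the features of \<open>xs\<close>, plus its mean.\<close>

definition energy :: "'x list \<Rightarrow> ('i \<Rightarrow> real) \<Rightarrow> real" where
  "energy xs a = (\<Sum>e\<in>basis xs. (dot J a e)\<^sup>2) + real (card (basis xs))"

lemma integrable_energy: "integrable (gauss J) (energy xs)"
  and integral_energy: "(\<integral>a. energy xs a \<partial>gauss J) = 2 * real (card (basis xs))"
proof -
  have E: "\<And>e. e \<in> basis xs \<Longrightarrow> dot J e e = 1"
    using basis(1)[of xs] by (auto simp: orthonormal_basis_for_def)
  show "integrable (gauss J) (energy xs)"
    unfolding energy_def
    by (intro Bochner_Integration.integrable_add Bochner_Integration.integrable_sum gauss_second_moment(1) finite_J) simp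
  have "(\<integral>a. energy xs a \<partial>gauss J) = (\<Sum>e\<in>basis xs. dot J e e) + real (card (basis xs))"
    unfolding energy_def
    by (subst Bochner_Integration.integral_add)
      (auto intro!: Bochner_Integration.integrable_sum gauss_second_moment(1) finite_J
        simp: gauss_second_moment[OF finite_J] gauss.prob_space)
  then show "(\<integral>a. energy xs a \<partial>gauss J) = 2 * real (card (basis xs))"
    using E by simp
qed

lemma integrable_cone_mult:
  assumes f: "integrable (gauss J) f"
  shows "integrable (gauss J) (\<lambda>a. indicator (cone xs) a * (f a :: real))"
proof -
  have "integrable (gauss J) (\<lambda>a. f a * indicator (cone xs) a)"
    by (rule integrable_real_mult_indicator[OF cone_sets f])
  then show ?thesis by (simp only: mult.commute[of "indicator _ _"])
qed

section \<open>Dependence of a new sample on the past, and the entropy chain rule\<close>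

text \<open>Split \<open>\<phi> x\<close> into its projection \<open>u x\<close> to the span of
  \<open>basis xs\<close> and the rest \<open>w x\<close>, which is orthogonal to all past features.
  Shifts along \<open>w x\<close> preserve \<open>cone xs\<close>, so
  \<open>gauss_sign_correlation\<close> applies to each \<open>x\<close>. On summing over
  \<open>x\<close>, isotropy evaluates the squared lengths of \<open>u x\<close> and the squares of
  \<open>dot J a (u x)\<close>, which together make up \<open>energy\<close>.\<close>

lemma sum_correlation_square_le:
  "(\<Sum>x\<in>X. (2 * gauss.prob (cone (x # xs)) - gauss.prob (cone xs))\<^sup>2) \<le>
    gauss.prob (cone xs) * (2 * real (card X) / real (card J) * (\<integral>a. indicator (cone xs) a * energy xs a \<partial>gauss J))"
proof -
  define E where "E = basis xs"
  have E: "finite E" "\<forall>e\<in>E. \<forall>e'\<in>E. dot J e e' = of_bool (e = e')"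
    and EX: "\<And>y i. y \<in> set xs \<Longrightarrow> i \<in> J \<Longrightarrow> \<phi> y i = (\<Sum>e\<in>E. dot J (\<phi> y) e * e i)"
    using basis(1)[of xs] unfolding orthonormal_basis_for_def E_def[symmetric] by blast+
  note proj = orthonormal_projection[OF E]
  define u where "u x = (\<lambda>i. \<Sum>e\<in>E. dot J (\<phi> x) e * e i)" for x
  define w where "w x = (\<lambda>i. \<phi> x i - u x i)" for x
  have we: "dot J e (w x) = 0" if "e \<in> E" for e x
    using proj[OF that, of "dot J (\<phi> x)"] by (simp add: dot_commute[of J e] w_def u_def dot_diff_left)
  have w_past: "dot J (w x) (\<phi> y) = 0" if "y \<in> set xs" for x y
  proof -
    have "dot J (w x) (\<phi> y) = dot J (\<lambda>i. \<Sum>e\<in>E. dot J (\<phi> y) e * e i) (w x)"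
      unfolding dot_commute[of J "w x"] using EX[OF that] by (intro dot_cong) simp_all
    then show ?thesis using we by (simp add: dot_sum_left)
  qed
  have uw: "dot J (u x) (w x) = 0" for x
    using we by (simp add: u_def dot_sum_left)
  have eu: "dot J e (u x) = dot J (\<phi> x) e" if "e \<in> E" for e x
    unfolding u_def by (subst dot_commute) (rule proj[OF that])
  have uu: "dot J (u x) (u x) = (\<Sum>e\<in>E. (dot J (\<phi> x) e)\<^sup>2)" for x
  proof -
    have "dot J (u x) (u x) = (\<Sum>e\<in>E. dot J (\<phi> x) e * dot J e (u x))"
      unfolding u_def by (rule dot_sum_left)
    also have "\<dots> = (\<Sum>e\<in>E. (dot J (\<phi> x) e)\<^sup>2)"
      using eu by (simp add: power2_eq_square)
    finally show ?thesis .
  qed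
  have norm: "real (card J) = dot J (u x) (u x) + dot J (w x) (w x)" if "x \<in> X" for x
  proof -
    have "dot J (\<phi> x) (\<phi> x) = dot J (u x) (u x) + 2 * dot J (u x) (w x) + dot J (w x) (w x)"
      unfolding w_def dot_def by (simp add: sum.distrib[symmetric] sum_distrib_left algebra_simps)
    then show ?thesis using norm_features[OF that] uw by simp
  qed
  define g where "g x a = 2 / real (card J) * ((dot J a (u x))\<^sup>2 + dot J (u x) (u x))" for x a
  have g_int: "integrable (gauss J) (\<lambda>a. indicator (cone xs) a * g x a)" for x
    unfolding g_def by (intro integrable_cone_mult integrable_mult_right Bochner_Integration.integrable_add
        gauss_second_moment(1) finite_J) simp
  have corr: "(2 * gauss.prob (cone (x # xs)) - gauss.prob (cone xs))\<^sup>2 \<le>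
      gauss.prob (cone xs) * (\<integral>a. indicator (cone xs) a * g x a \<partial>gauss J)" if x: "x \<in> X" for x
  proof -
    have "(\<lambda>j\<in>J. a j + t * w x j) \<in> cone xs \<longleftrightarrow> a \<in> cone xs" if "a \<in> extensional J" for a t
      using that w_past[of _ x] by (auto simp: cone_def dot_add_scale_left)
    from gauss_sign_correlation[OF finite_J cone_sets this uw norm[OF x]]
    have "(2 * gauss.prob {a\<in>cone xs. dot J a (\<lambda>i. u x i + w x i) \<ge> 0} - gauss.prob (cone xs))\<^sup>2 \<le>
      gauss.prob (cone xs) * (\<integral>a. indicator (cone xs) a * g x a \<partial>gauss J)"
      using card_J_pos by (simp add: g_def)
    moreover have "{a\<in>cone xs. dot J a (\<lambda>i. u x i + w x i) \<ge> 0} = cone (x # xs)"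
      by (auto simp: cone_def w_def)
    ultimately show ?thesis by simp
  qed
  have sum_g: "(\<Sum>x\<in>X. g x a) = 2 * real (card X) / real (card J) * energy xs a" for a
  proof -
    \<comment> \<open>The projection is moved from \<open>\<phi> x\<close> to \<open>a\<close>: with
      \<open>b\<close> the projection of \<open>a\<close>, the sum over \<open>x\<close> becomes an
      instance of isotropy.\<close>
    define b where "b = (\<lambda>i. \<Sum>e\<in>E. dot J a e * e i)"
    have "dot J a (u x) = dot J (\<phi> x) b" for x
    proof -
      have "dot J a (u x) = dot J (u x) a" by (rule dot_commute)
      also have "\<dots> = (\<Sum>e\<in>E. dot J (\<phi> x) e * dot J e a)"
        unfolding u_def by (rule dot_sum_left)
      also have "\<dots> = (\<Sum>e\<in>E. dot J a e * dot J e (\<phi> x))"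
        by (intro sum.cong refl) (metis dot_commute mult.commute)
      also have "\<dots> = dot J b (\<phi> x)"
        unfolding b_def by (rule dot_sum_left[symmetric])
      also have "\<dots> = dot J (\<phi> x) b" by (rule dot_commute)
      finally show ?thesis .
    qed
    then have "(\<Sum>x\<in>X. (dot J a (u x))\<^sup>2) = real (card X) * dot J b b"
      using sum_dot_features[of b b] by (simp add: power2_eq_square)
    also have "dot J b b = (\<Sum>e\<in>E. dot J a e * dot J e b)"
      unfolding b_def by (rule dot_sum_left)
    also have "\<dots> = (\<Sum>e\<in>E. (dot J a e)\<^sup>2)"
    proof (intro sum.cong refl)
      fix e assume "e \<in> E"
      then have "dot J e b = dot J a e"
        unfolding b_def by (subst dot_commute) (rule proj)
      then show "dot J a e * dot J e b = (dot J a e)\<^sup>2" by (simp add: power2_eq_square)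
    qed
    finally have 1: "(\<Sum>x\<in>X. (dot J a (u x))\<^sup>2) = real (card X) * (\<Sum>e\<in>E. (dot J a e)\<^sup>2)" .
    have "(\<Sum>x\<in>X. dot J (u x) (u x)) = (\<Sum>e\<in>E. \<Sum>x\<in>X. dot J (\<phi> x) e * dot J (\<phi> x) e)"
      unfolding uu power2_eq_square by (rule sum.swap)
    also have "\<dots> = real (card X) * real (card E)"
      using E(2) by (simp add: sum_dot_features)
    finally have 2: "(\<Sum>x\<in>X. dot J (u x) (u x)) = real (card X) * real (card E)" .
    show ?thesis
      unfolding g_def sum_distrib_left[symmetric] sum.distrib 1 2 energy_def E_def[symmetric]
      by (simp add: algebra_simps)
  qed
  have "(\<Sum>x\<in>X. (2 * gauss.prob (cone (x # xs)) - gauss.prob (cone xs))\<^sup>2) \<le>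
      (\<Sum>x\<in>X. gauss.prob (cone xs) * (\<integral>a. indicator (cone xs) a * g x a \<partial>gauss J))"
    by (intro sum_mono corr)
  also have "\<dots> = gauss.prob (cone xs) * (\<integral>a. (\<Sum>x\<in>X. indicator (cone xs) a * g x a) \<partial>gauss J)"
    by (simp add: sum_distrib_left g_int)
  also have "(\<lambda>a. \<Sum>x\<in>X. indicator (cone xs) a * g x a) =
      (\<lambda>a. 2 * real (card X) / real (card J) * (indicator (cone xs) a * energy xs a))"
    by (simp only: sum_distrib_left[symmetric] sum_g mult.left_commute)
  finally show ?thesis by simp
qed

text \<open>Expansion by \<open>xlnx_add_le\<close> around \<open>lratio xs\<close>: the linear term
  sums to 0 by \<open>sum_lratio_Cons\<close>, and in the quadratic term the division by
  \<open>lratio xs\<close> cancels the factor \<open>gauss.prob (cone xs)\<close> of the correlation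
  bound.\<close>

lemma sum_xlnx_lratio_Cons:
  "(\<Sum>x\<in>X. lratio (x # xs) * ln (lratio (x # xs))) \<le> real (card X) * (lratio xs * ln (lratio xs)) +
     2 * real (card X) / real (card J) * (2 ^ length xs * (\<integral>a. indicator (cone xs) a * energy xs a \<partial>gauss J))"
proof (cases "gauss.prob (cone xs) = 0")
  case True
  \<comment> \<open>The expansion needs a positive base point. A null cone has only null extensions,
    and \<open>0 * ln 0 = 0\<close>.\<close>
  have "cone (x # xs) \<subseteq> cone xs" for x by (auto simp: cone_def)
  then have "gauss.prob (cone (x # xs)) = 0" for x
    using gauss.finite_measure_mono[of "cone (x # xs)" "cone xs"] True cone_sets
    by (simp add: measure_le_0_iff)
  moreover have "energy xs a \<ge> 0" for a by (simp add: energy_def sum_nonneg)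
  ultimately show ?thesis
    using True by (simp add: lratio_def)
next
  case False
  define k where "k = (2::real) ^ length xs"
  define P where "P = gauss.prob (cone xs)"
  define C where "C x = 2 * gauss.prob (cone (x # xs)) - P" for x
  have pos: "P > 0" "k > 0" using False by (auto simp: P_def k_def zero_less_measure_iff)
  have K: "lratio xs = k * P" by (simp add: lratio_def k_def P_def)
  have diff: "lratio (x # xs) - lratio xs = k * C x" for x
    by (simp add: lratio_def k_def P_def C_def algebra_simps)
  have "(\<Sum>x\<in>X. k * C x) = 0"
    using sum_lratio_Cons[of xs] by (simp add: diff[symmetric] sum_subtractf)
  have "(\<Sum>x\<in>X. lratio (x # xs) * ln (lratio (x # xs))) \<le>
      (\<Sum>x\<in>X. lratio xs * ln (lratio xs) + k * C x * (1 + ln (lratio xs)) + (k * C x)\<^sup>2 / lratio xs)"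
    unfolding diff[symmetric] using pos by (intro sum_mono xlnx_add_le lratio_nonneg) (simp add: K)
  also have "\<dots> = real (card X) * (lratio xs * ln (lratio xs)) + (\<Sum>x\<in>X. k * C x) * (1 + ln (lratio xs)) +
      k / P * (\<Sum>x\<in>X. (C x)\<^sup>2)"
    using pos by (simp add: sum.distrib sum_distrib_right sum_distrib_left K power2_eq_square mult_ac)
  also have "(\<Sum>x\<in>X. k * C x) = 0" by fact
  also have "k / P * (\<Sum>x\<in>X. (C x)\<^sup>2) \<le> k / P * (P * (2 * real (card X) / real (card J) *
      (\<integral>a. indicator (cone xs) a * energy xs a \<partial>gauss J)))"
    using pos sum_correlation_square_le[of xs] unfolding C_def P_def by (intro mult_left_mono) auto
  finally show ?thesis
    using pos by (simp add: k_def mult_ac)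
qed

text \<open>\<open>2 ^ length xs\<close> times the indicator of the cone is the likelihood ratio for
  a fixed \<open>a\<close>. As \<open>energy\<close> is unchanged by flips, samples from the
  halfspace of a generic \<open>a\<close> may be replaced by uniform ones, which do not depend on
  \<open>a\<close>; the Gaussian mean of the energy is then at most \<open>2 * k\<close>.\<close>

lemma sum_integral_energy_le:
  "(\<Sum>xs\<in>samples X k. 2 ^ length xs * (\<integral>a. indicator (cone xs) a * energy xs a \<partial>gauss J)) \<le>
     real (card X) ^ k * (2 * real k)"
proof -
  have fin: "finite (samples X k)"
    using finite_lists_length_eq[OF finite_X, of k] by simp
  have "(\<Sum>xs\<in>samples X k. 2 ^ length xs * (\<integral>a. indicator (cone xs) a * energy xs a \<partial>gauss J)) =
      (\<integral>a. (\<Sum>xs\<in>samples X k. 2 ^ length xs * (indicator (cone xs) a * energy xs a)) \<partial>gauss J)"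
    by (subst Bochner_Integration.integral_sum) (auto intro!: integrable_mult_right integrable_cone_mult integrable_energy)
  also have "\<dots> = (\<integral>a. (\<Sum>xs\<in>samples X k. energy xs a) \<partial>gauss J)"
  proof (rule integral_cong_AE)
    show "AE a in gauss J. (\<Sum>xs\<in>samples X k. 2 ^ length xs * (indicator (cone xs) a * energy xs a)) =
        (\<Sum>xs\<in>samples X k. energy xs a)"
      using AE_generic AE_space
    proof eventually_elim
      case (elim a)
      have "(\<Sum>xs\<in>samples X k. 2 ^ length xs * (indicator (cone xs) a * energy xs a)) =
          (\<Sum>xs\<in>samples X k. 2 ^ k * of_bool (\<forall>x\<in>set xs. dot J a (\<phi> x) \<ge> 0) * energy xs a)"
        using elim(2) by (intro sum.cong) (auto simp: cone_def space_gauss indicator_def)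
      also have "\<dots> = (\<Sum>xs\<in>samples X k. energy xs a)"
        by (intro sum_samples_flip_invariant elim) (simp add: energy_def basis_flip)
      finally show ?case .
    qed
  qed (use borel_measurable_integrable[OF integrable_energy] in measurable)
  also have "\<dots> = (\<Sum>xs\<in>samples X k. 2 * real (card (basis xs)))"
    by (simp add: integrable_energy integral_energy)
  also have "\<dots> \<le> (\<Sum>xs\<in>samples X k. 2 * real k)"
    using basis(2) by (intro sum_mono) fastforce
  also have "\<dots> = real (card X) ^ k * (2 * real k)"
    using card_lists_length_eq[OF finite_X, of k] by simp
  finally show ?thesis .
qed

text \<open>Chain rule: divided by the number of sample lists, the step from \<open>k\<close> to
  \<open>Suc k\<close> samples costs at most \<open>4 * k / card J\<close>, and the costs for
  \<open>k < m\<close> add up to at most \<open>2 * m\<^sup>2 / card J\<close>.\<close>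

lemma sum_xlnx_lratio:
  "(\<Sum>xs\<in>samples X m. lratio xs * ln (lratio xs)) \<le> real (card X) ^ m * (2 * (real m)\<^sup>2 / real (card J))"
proof (induction m)
  case 0
  have "samples X 0 = {[]}" by auto
  moreover have "cone [] = space (gauss J)" by (simp add: cone_def space_gauss)
  ultimately show ?case using gauss.prob_space by (simp add: lratio_def)
next
  case (Suc m)
  have "(\<Sum>xs\<in>samples X (Suc m). lratio xs * ln (lratio xs)) \<le>
      (\<Sum>xs\<in>samples X m. real (card X) * (lratio xs * ln (lratio xs)) + 2 * real (card X) / real (card J) *
        (2 ^ length xs * (\<integral>a. indicator (cone xs) a * energy xs a \<partial>gauss J)))"
    unfolding sum_samples_Suc by (intro sum_mono sum_xlnx_lratio_Cons)
  also have "\<dots> = real (card X) * (\<Sum>xs\<in>samples X m. lratio xs * ln (lratio xs)) + 2 * real (card X) / real (card J) *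
        (\<Sum>xs\<in>samples X m. 2 ^ length xs * (\<integral>a. indicator (cone xs) a * energy xs a \<partial>gauss J))"
    by (simp only: sum.distrib sum_distrib_left)
  also have "\<dots> \<le> real (card X) * (real (card X) ^ m * (2 * (real m)\<^sup>2 / real (card J))) +
      2 * real (card X) / real (card J) * (real (card X) ^ m * (2 * real m))"
    by (intro add_mono mult_left_mono Suc.IH sum_integral_energy_le) auto
  also have "\<dots> = real (card X) ^ Suc m * ((2 * (real m)\<^sup>2 + 4 * real m) / real (card J))"
    by (simp add: add_divide_distrib algebra_simps)
  also have "\<dots> \<le> real (card X) ^ Suc m * (2 * (real (Suc m))\<^sup>2 / real (card J))"
    by (intro mult_left_mono divide_right_mono) (auto simp: power2_eq_square algebra_simps)
  finally show ?case .
qed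

section \<open>From a successful test to the number of features\<close>

text \<open>With \<open>E\<close> the uniform average over sample lists and \<open>K\<close> the
  likelihood ratio, the hypotheses give \<open>E[t K] \<ge> 0.99\<close> and
  \<open>E[t] \<le> 0.01\<close>, while \<open>E[K] = 1\<close>. Weighting the tangent at
  \<open>exp 1\<close> by \<open>t\<close> and the one at \<open>1\<close> by \<open>1 - t\<close>
  yields \<open>E[K ln K] \<ge> E[t K] - (exp 1 - 1) E[t] + E[K] - 1 \<ge> 0.97\<close>, to be
  compared with the upper bound \<open>sum_xlnx_lratio\<close>.\<close>

lemma card_features_le:
  assumes t: "\<And>xs. 0 \<le> t xs" "\<And>xs. t xs \<le> (1::real)"
    and uniform: "(\<Sum>xs\<in>samples X m. t xs) \<le> 1 / 100 * real (card X) ^ m"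
    and halfspace: "\<And>a. generic a \<Longrightarrow> (\<Sum>xs\<in>samples X m. 2 ^ m * of_bool (\<forall>x\<in>set xs. dot J a (\<phi> x) \<ge> 0) * t xs)
        \<ge> 99 / 100 * real (card X) ^ m"
  shows "real (card J) \<le> 4 * (real m)\<^sup>2"
proof -
  define M where "M = real (card X) ^ m"
  have M: "M > 0" using card_X_pos by (simp add: M_def)
  \<comment> \<open>The guarantee holds for almost every \<open>a\<close>; integrating over
    \<open>a\<close> turns the halfspace laws into their mixture, whose likelihood ratio is
    \<open>lratio\<close>.\<close>
  have "99 / 100 * M = (\<integral>a. 99 / 100 * M \<partial>gauss J)"
    using gauss.prob_space by simp
  also have "\<dots> \<le> (\<integral>a. (\<Sum>xs\<in>samples X m. 2 ^ m * t xs * of_bool (\<forall>x\<in>set xs. dot J a (\<phi> x) \<ge> 0)) \<partial>gauss J)"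
  proof (rule integral_mono_AE)
    show "AE a in gauss J. 99 / 100 * M \<le> (\<Sum>xs\<in>samples X m. 2 ^ m * t xs * of_bool (\<forall>x\<in>set xs. dot J a (\<phi> x) \<ge> 0))"
      using AE_generic
    proof eventually_elim
      case (elim a)
      then show ?case using halfspace[OF elim] by (simp add: M_def mult_ac)
    qed
    show "integrable (gauss J) (\<lambda>a. \<Sum>xs\<in>samples X m. 2 ^ m * t xs * of_bool (\<forall>x\<in>set xs. dot J a (\<phi> x) \<ge> 0))"
      by (intro Bochner_Integration.integrable_sum integrable_mult_right integrable_cone)
  qed simp
  also have "\<dots> = (\<Sum>xs\<in>samples X m. 2 ^ m * t xs * gauss.prob (cone xs))"
    by (subst Bochner_Integration.integral_sum) (auto intro!: integrable_mult_right integrable_cone simp: prob_cone)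
  also have "\<dots> = (\<Sum>xs\<in>samples X m. t xs * lratio xs)"
    by (intro sum.cong) (auto simp: lratio_def)
  finally have tK: "99 / 100 * M \<le> (\<Sum>xs\<in>samples X m. t xs * lratio xs)" .
  \<comment> \<open>The bound \<open>exp 1 \<le> 3\<close> limits the loss
    \<open>(exp 1 - 1) / 100\<close> to \<open>2 / 100\<close>.\<close>
  have e: "1 \<le> exp (1::real)" "exp 1 \<le> (3::real)" using exp_le exp_ge_add_one_self[of 1] by auto
  have "97 / 100 * M \<le> 99 / 100 * M - (exp 1 - 1) * (1 / 100 * M)"
    using e M by (simp add: algebra_simps)
  also have "\<dots> \<le> (\<Sum>xs\<in>samples X m. t xs * lratio xs) - (exp 1 - 1) * (\<Sum>xs\<in>samples X m. t xs)"
    using tK uniform e by (intro diff_mono mult_left_mono) (auto simp: M_def)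
  also have "\<dots> = (\<Sum>xs\<in>samples X m. t xs * lratio xs) - (exp 1 - 1) * (\<Sum>xs\<in>samples X m. t xs)
      + (\<Sum>xs\<in>samples X m. lratio xs) - (\<Sum>xs\<in>samples X m. 1)"
    using card_lists_length_eq[OF finite_X, of m] by (simp add: sum_lratio)
  also have "\<dots> = (\<Sum>xs\<in>samples X m. t xs * (2 * lratio xs - exp 1) + (1 - t xs) * (lratio xs - 1))"
    unfolding sum_distrib_left sum_subtractf[symmetric] sum.distrib[symmetric]
    by (intro sum.cong) (auto simp: algebra_simps)
  also have "\<dots> \<le> (\<Sum>xs\<in>samples X m. t xs * (lratio xs * ln (lratio xs)) + (1 - t xs) * (lratio xs * ln (lratio xs)))"
    using t by (intro sum_mono add_mono mult_left_mono xlnx_ge_tangent lratio_nonneg) auto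
  also have "\<dots> = (\<Sum>xs\<in>samples X m. lratio xs * ln (lratio xs))"
    by (intro sum.cong) (auto simp: algebra_simps)
  also have "\<dots> \<le> M * (2 * (real m)\<^sup>2 / real (card J))"
    unfolding M_def by (rule sum_xlnx_lratio)
  finally have "M * (97 / 100) \<le> M * (2 * (real m)\<^sup>2 / real (card J))"
    by (simp only: mult.commute)
  then have "97 / 100 \<le> 2 * (real m)\<^sup>2 / real (card J)"
    using M by (simp only: mult_le_cancel_left_pos)
  \<comment> \<open>Here \<open>2 / 0.97\<close> is rounded up to 4, whose root 2 enters the final
    constant.\<close>
  then show ?thesis
    using card_J_pos by (simp add: field_simps)
qed

end

subsection \<open>Polynomial threshold functions\<close>

lemma hypercube_memD: "x \<in> hypercube n \<Longrightarrow> i < n \<Longrightarrow> x i = 1 \<or> x i = -1"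
  by (auto simp: hypercube_def PiE_def)

definition flip_on :: "nat set \<Rightarrow> point \<Rightarrow> point" where
  "flip_on B x = (\<lambda>i. if i \<in> B then - x i else x i)"

lemma flip_on_bij:
  assumes "B \<subseteq> {..<n}"
  shows "bij_betw (flip_on B) (hypercube n) (hypercube n)"
proof (rule bij_betw_byWitness[where f' = "flip_on B"])
  have mem: "flip_on B x \<in> hypercube n" if "x \<in> hypercube n" for x
  proof -
    have "flip_on B x i \<in> {-1, 1}" if "i < n" for i
      using hypercube_memD[OF \<open>x \<in> hypercube n\<close> that] by (auto simp: flip_on_def)
    moreover have "flip_on B x i = undefined" if "\<not> i < n" for i
      using that assms \<open>x \<in> hypercube n\<close> by (auto simp: flip_on_def hypercube_def PiE_def extensional_def)
    ultimately show ?thesis by (auto simp: hypercube_def PiE_def extensional_def)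
  qed
  then show "flip_on B ` hypercube n \<subseteq> hypercube n" "flip_on B ` hypercube n \<subseteq> hypercube n" by auto
qed (auto simp: flip_on_def)

lemma prod_flip_on:
  assumes "finite S"
  shows "(\<Prod>i\<in>S. flip_on B x i) = (-1) ^ card (S \<inter> B) * (\<Prod>i\<in>S. x i)"
proof -
  have "(\<Prod>i\<in>S. flip_on B x i) = (\<Prod>i\<in>S. (if i \<in> B then -1 else 1) * x i)"
    by (intro prod.cong) (auto simp: flip_on_def)
  also have "\<dots> = (\<Prod>i\<in>S. if i \<in> B then -1 else 1) * (\<Prod>i\<in>S. x i)"
    by (rule prod.distrib)
  also have "(\<Prod>i\<in>S. if i \<in> B then -1 else 1) = (-1::real) ^ card (S \<inter> B)"
    using assms by (simp add: prod.If_cases Int_def)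
  finally show ?thesis .
qed

lemma prod_hypercube_square:
  assumes "x \<in> hypercube n" "S \<subseteq> {..<n}"
  shows "(\<Prod>i\<in>S. x i) * (\<Prod>i\<in>S. x i) = 1"
proof -
  have "(\<Prod>i\<in>S. x i * x i) = (\<Prod>i\<in>S. 1)"
    using hypercube_memD[OF assms(1)] assms(2) by (intro prod.cong) fastforce+
  then show ?thesis by (simp add: prod.distrib)
qed

text \<open>Some coordinate \<open>i\<close> lies in exactly one of \<open>S\<close> and
  \<open>T\<close>; flipping it permutes the cube and negates every summand.\<close>

lemma characters_orthogonal:
  assumes "S \<subseteq> {..<n}" "T \<subseteq> {..<n}" "S \<noteq> T"
  shows "(\<Sum>x\<in>hypercube n. (\<Prod>i\<in>S. x i) * (\<Prod>i\<in>T. x i)) = 0"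
proof -
  have fin: "finite S" "finite T" using assms finite_subset by blast+
  obtain i where i: "i \<in> S \<longleftrightarrow> i \<notin> T" using assms(3) by blast
  then have "i < n" using assms by auto
  have "(\<Prod>j\<in>S. flip_on {i} x j) * (\<Prod>j\<in>T. flip_on {i} x j) = - ((\<Prod>j\<in>S. x j) * (\<Prod>j\<in>T. x j))" for x
    using i by (cases "i \<in> S") (simp_all add: prod_flip_on fin)
  then have "(\<Sum>x\<in>hypercube n. (\<Prod>i\<in>S. x i) * (\<Prod>i\<in>T. x i)) =
      - (\<Sum>x\<in>hypercube n. (\<Prod>i\<in>S. x i) * (\<Prod>i\<in>T. x i))"
    using sum.reindex_bij_betw[OF flip_on_bij[of "{i}" n], of "\<lambda>x. (\<Prod>i\<in>S. x i) * (\<Prod>i\<in>T. x i)"] \<open>i < n\<close>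
    by (simp add: sum_negf)
  then show ?thesis by simp
qed

text \<open>Flipping \<open>B\<close> multiplies the character of \<open>S\<close> by
  \<open>(-1) ^ card (S \<inter> B)\<close>, so odd intersections provide the symmetry that negates
  all features. Isotropy is orthogonality of characters, and the norm is constant because their
  values are signs.\<close>

lemma isotropic_features_characters:
  assumes J: "finite J" "J \<noteq> {}" "\<And>S. S \<in> J \<Longrightarrow> S \<subseteq> {..<n}"
    and B: "B \<subseteq> {..<n}" "\<And>S. S \<in> J \<Longrightarrow> odd (card (S \<inter> B))"
  shows "isotropic_features (hypercube n) J (\<lambda>x S. \<Prod>i\<in>S. x i) (flip_on B)"
proof
  fix S T assume ST: "S \<in> J" "T \<in> J"
  show "(\<Sum>x\<in>hypercube n. (\<Prod>i\<in>S. x i) * (\<Prod>i\<in>T. x i)) = (if S = T then real (card (hypercube n)) else 0)"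
    using J(3) ST characters_orthogonal[of S n T] by (simp add: prod_hypercube_square)
next
  fix x assume x: "x \<in> hypercube n"
  show "dot J (\<lambda>S. \<Prod>i\<in>S. x i) (\<lambda>S. \<Prod>i\<in>S. x i) = real (card J)"
    using x J by (simp add: dot_def prod_hypercube_square)
next
  fix x S assume "x \<in> hypercube n" "S \<in> J"
  then have "finite S" "odd (card (S \<inter> B))" using J(3) B(2) finite_subset by blast+
  then show "(\<Prod>i\<in>S. flip_on B x i) = - (\<Prod>i\<in>S. x i)"
    by (simp add: prod_flip_on)
qed (use J finite_hypercube hypercube_nonempty flip_on_bij[OF B(1)] in auto)

section \<open>Multilinear polynomials and the output law of an algorithm\<close>

lemma multilinear_mpoly_exists:
  assumes J: "finite J" "\<And>S. S \<in> J \<Longrightarrow> S \<subseteq> {..<n}" "\<And>S. S \<in> J \<Longrightarrow> card S \<le> d"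
  shows "\<exists>p\<in>mpolys_upto n d. \<forall>x. mpoly_eval p x = (\<Sum>S\<in>J. a S * (\<Prod>i\<in>S. x i))"
proof -
  \<comment> \<open>The squarefree monomial of \<open>S\<close>. Its \<open>keys\<close> recover the
    set, so distinct sets have distinct monomials and no coefficients merge.\<close>
  define mono where "mono S = Abs_poly_mapping (\<lambda>i::nat. of_bool (i \<in> S) :: nat)" for S
  have lookup_mono: "Poly_Mapping.lookup (mono S) = (\<lambda>i. of_bool (i \<in> S))" if "S \<in> J" for S
  proof -
    have "finite S" using J(2)[OF that] finite_subset by blast
    then have "finite {i. (of_bool (i \<in> S) :: nat) \<noteq> 0}" by simp
    then show ?thesis unfolding mono_def by (rule lookup_Abs_poly_mapping)
  qed
  have keys_mono: "Poly_Mapping.keys (mono S) = S" if "S \<in> J" for S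
    using lookup_mono[OF that] by (auto simp: Poly_Mapping.keys.rep_eq)
  define p where "p = Abs_poly_mapping (\<lambda>t. if t \<in> mono ` J then a (Poly_Mapping.keys t) else 0)"
  have "finite {t. (if t \<in> mono ` J then a (Poly_Mapping.keys t) else 0) \<noteq> 0}"
    by (rule finite_subset[of _ "mono ` J"]) (use J(1) in auto)
  then have lookup_p: "Poly_Mapping.lookup p = (\<lambda>t. if t \<in> mono ` J then a (Poly_Mapping.keys t) else 0)"
    unfolding p_def by (rule lookup_Abs_poly_mapping)
  have keys_p: "Poly_Mapping.keys p \<subseteq> mono ` J"
    by (auto simp: Poly_Mapping.keys.rep_eq lookup_p split: if_splits)
  have inj: "inj_on mono J"
    by (rule inj_on_inverseI[of _ Poly_Mapping.keys]) (rule keys_mono)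
  have "p \<in> mpolys_upto n d"
    unfolding mpolys_upto_def
  proof (intro CollectI ballI)
    fix t assume "t \<in> Poly_Mapping.keys p"
    then obtain S where S: "S \<in> J" "t = mono S" using keys_p by auto
    then show "Poly_Mapping.keys t \<subseteq> {..<n} \<and> monomial_degree t \<le> d"
      using J(2,3)[OF S(1)] by (simp add: monomial_degree_def keys_mono lookup_mono)
  qed
  moreover have "mpoly_eval p x = (\<Sum>S\<in>J. a S * (\<Prod>i\<in>S. x i))" for x
  proof -
    have "mpoly_eval p x = (\<Sum>t\<in>mono ` J. Poly_Mapping.lookup p t *
        (\<Prod>i\<in>Poly_Mapping.keys t. x i ^ Poly_Mapping.lookup t i))"
      unfolding mpoly_eval_def using J(1) keys_p
      by (intro sum.mono_neutral_left) (auto simp: in_keys_iff)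
    also have "\<dots> = (\<Sum>S\<in>J. a S * (\<Prod>i\<in>S. x i))"
      by (simp add: sum.reindex[OF inj] lookup_p keys_mono lookup_mono)
    finally show ?thesis .
  qed
  ultimately show ?thesis by blast
qed

lemma pmf_replicate_pmf: "pmf (replicate_pmf (length xs) D) xs = (\<Prod>x\<leftarrow>xs. pmf D x)"
proof (induction xs)
  case (Cons x xs)
  have "replicate_pmf (length (x # xs)) D = map_pmf (\<lambda>(x, xs). x # xs) (pair_pmf D (replicate_pmf (length xs) D))"
    by (simp add: pair_pmf_def map_bind_pmf)
  moreover have "inj (\<lambda>(x :: 'a, xs). x # xs)" by (auto simp: inj_on_def)
  ultimately have "pmf (replicate_pmf (length (x # xs)) D) (x # xs) = pmf (pair_pmf D (replicate_pmf (length xs) D)) (x, xs)"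
    using pmf_map_inj'[of "\<lambda>(x, xs). x # xs" "pair_pmf D (replicate_pmf (length xs) D)" "(x, xs)"] by simp
  then show ?case using Cons.IH by (simp add: pmf_pair)
qed simp

lemma pmf_run_algorithm:
  assumes X: "finite X" "set_pmf D \<subseteq> X"
  shows "pmf (run_algorithm m A D) v = (\<Sum>xs\<in>samples X m. (\<Prod>x\<leftarrow>xs. pmf D x) * pmf (A xs) v)"
proof -
  have "pmf (run_algorithm m A D) v = measure_pmf.expectation (replicate_pmf m D) (\<lambda>xs. pmf (A xs) v)"
    by (simp add: run_algorithm_def pmf_bind)
  also have "\<dots> = (\<Sum>xs\<in>samples X m. pmf (A xs) v * pmf (replicate_pmf m D) xs)"
    using finite_lists_length_eq[OF X(1), of m] X(2)
    by (intro integral_measure_pmf_real) (auto simp: set_replicate_pmf)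
  also have "\<dots> = (\<Sum>xs\<in>samples X m. (\<Prod>x\<leftarrow>xs. pmf D x) * pmf (A xs) v)"
    using pmf_replicate_pmf by (intro sum.cong) auto
  finally show ?thesis .
qed

section \<open>A large family of block monomials\<close>

text \<open>Take \<open>d\<close> blocks of length \<open>N = n div d\<close>; \<open>T\<close>
  chooses the element at offset \<open>T b\<close> in block \<open>b\<close>. Each such choice has
  exactly one element in the first block, so \<open>B = {..<N}\<close> meets it in an odd number of
  points.\<close>

lemma odd_block_family:
  assumes "d \<ge> 1"
  shows "\<exists>J B. finite J \<and> card J = (n div d) ^ d \<and> B \<subseteq> {..<n} \<and>
    (\<forall>S\<in>J. S \<subseteq> {..<n} \<and> card S \<le> d \<and> odd (card (S \<inter> B)))"
proof -
  define N where "N = n div d"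
  define blk where "blk T = (\<lambda>b. b * N + T b) ` {..<d}" for T :: "nat \<Rightarrow> nat"
  define F where "F = {..<d} \<rightarrow>\<^sub>E {..<N}"
  have T: "T b < N" if "T \<in> F" "b < d" for T b
    using that by (auto simp: F_def PiE_def)
  have dN: "d * N \<le> n" by (simp add: N_def)
  have "inj_on blk F"
  proof (rule inj_onI)
    fix T T' assume F: "T \<in> F" "T' \<in> F" and eq: "blk T = blk T'"
    show "T = T'"
    proof (rule PiE_ext)
      fix b assume b: "b \<in> {..<d}"
      then have "b * N + T b \<in> blk T'" unfolding eq[symmetric] by (auto simp: blk_def)
      then obtain b' where b': "b' < d" "b * N + T b = b' * N + T' b'" by (auto simp: blk_def)
      \<comment> \<open>Division by \<open>N\<close> recovers the block, so equal elements come from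
        the same block with the same offset.\<close>
      have "(b * N + T b) div N = b" "(b' * N + T' b') div N = b'"
        using T[OF F(1)] T[OF F(2) b'(1)] b by auto
      then show "T b = T' b" using b'(2) by auto
    qed (use F in \<open>auto simp: F_def\<close>)
  qed
  then have "card (blk ` F) = N ^ d"
    by (simp add: card_image F_def card_PiE)
  moreover have "finite (blk ` F)" by (simp add: F_def finite_PiE)
  moreover have "{..<N} \<subseteq> {..<n}" by (auto simp: N_def intro: less_le_trans div_le_dividend)
  moreover have "S \<subseteq> {..<n} \<and> card S \<le> d \<and> odd (card (S \<inter> {..<N}))" if "S \<in> blk ` F" for S
  proof -
    obtain T where TF: "T \<in> F" and S: "S = blk T" using \<open>S \<in> blk ` F\<close> by auto
    have "b * N + T b < n" if "b < d" for b
    proof -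
      have "b * N + T b < Suc b * N" using T[OF TF that] by simp
      also have "\<dots> \<le> d * N" using that by (intro mult_right_mono) auto
      finally show ?thesis using dN by simp
    qed
    moreover have "card (blk T) \<le> d"
      using card_image_le[of "{..<d}"] by (simp add: blk_def)
    moreover have "blk T \<inter> {..<N} = {T 0}"
    proof -
      have zero: "b = 0" if "b * N + T b < N" for b
        using that by (cases b) auto
      show ?thesis
      proof (intro set_eqI iffI)
        fix i assume "i \<in> blk T \<inter> {..<N}"
        then obtain b where "i = b * N + T b" "b * N + T b < N" by (auto simp: blk_def)
        with zero[of b] show "i \<in> {T 0}" by simp
      next
        fix i assume "i \<in> {T 0}"
        then show "i \<in> blk T \<inter> {..<N}"
          using assms T[OF TF, of 0] by (auto simp: blk_def intro!: image_eqI[of _ _ 0])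
      qed
    qed
    ultimately show ?thesis by (auto simp: S blk_def)
  qed
  ultimately show ?thesis
    unfolding N_def by (intro exI[of _ "blk ` F"] exI[of _ "{..<N}"]) (auto simp: N_def)
qed

section \<open>The lower bound on the number of samples\<close>

text \<open>This form covers both laws: the uniform one with \<open>c = 1 / card X\<close> and
  \<open>P\<close> always true, and the truncated one with \<open>c = 2 / card X\<close> and
  \<open>P\<close> the halfspace.\<close>

lemma pmf_run_algorithm_const:
  assumes X: "finite X" "set_pmf D \<subseteq> X" and D: "\<And>x. x \<in> X \<Longrightarrow> pmf D x = c * of_bool (P x)"
  shows "pmf (run_algorithm m A D) v = (\<Sum>xs\<in>samples X m. c ^ m * of_bool (\<forall>x\<in>set xs. P x) * pmf (A xs) v)"
proof -
  have "(\<Prod>x\<leftarrow>xs. pmf D x) = c ^ length xs * of_bool (\<forall>x\<in>set xs. P x)" if "set xs \<subseteq> X" for xs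
    using that by (induction xs) (auto simp: D)
  then show ?thesis
    unfolding pmf_run_algorithm[OF X] by (intro sum.cong) auto
qed

text \<open>The probability of \<open>Truncated\<close> serves as \<open>t\<close> in
  \<open>card_features_le\<close>. Each generic \<open>a\<close> gives a threshold function of
  degree at most \<open>d\<close> and volume exactly \<open>1 / 2\<close>, so that tolerance 0
  already admits it.\<close>

lemma truncation_tester_lower_bound:
  assumes tester: "truncation_tester n d 0 m A"
    and J: "finite J" "J \<noteq> {}" "\<And>S. S \<in> J \<Longrightarrow> S \<subseteq> {..<n}" "\<And>S. S \<in> J \<Longrightarrow> card S \<le> d"
    and B: "B \<subseteq> {..<n}" "\<And>S. S \<in> J \<Longrightarrow> odd (card (S \<inter> B))"
  shows "real (card J) \<le> 4 * (real m)\<^sup>2"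
proof -
  define X where "X = hypercube n"
  define \<phi> :: "point \<Rightarrow> nat set \<Rightarrow> real" where "\<phi> = (\<lambda>x S. \<Prod>i\<in>S. x i)"
  interpret isotropic_features X J \<phi> "flip_on B"
    unfolding X_def \<phi>_def using J B by (intro isotropic_features_characters) auto
  have unif: "uniform_hypercube n = pmf_of_set X" by (simp add: uniform_hypercube_def X_def)
  show ?thesis
  proof (rule card_features_le[where t = "\<lambda>xs. pmf (A xs) Truncated"])
    show "0 \<le> pmf (A xs) Truncated" "pmf (A xs) Truncated \<le> 1" for xs
      by (simp_all add: pmf_le_1)
  next
    have UNIV: "(UNIV :: verdict set) = {Untruncated, Truncated}"
      using verdict.exhaust by auto
    have total: "pmf q Untruncated + pmf q Truncated = 1" for q :: "verdict pmf"
    proof -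
      have "sum (pmf q) {Untruncated, Truncated} = 1"
      proof (rule sum_pmf_eq_1)
        show "set_pmf q \<subseteq> {Untruncated, Truncated}" using UNIV by blast
      qed simp
      then show ?thesis by simp
    qed
    have "pmf (run_algorithm m A (uniform_hypercube n)) Untruncated \<ge> 99 / 100"
      using tester by (simp add: truncation_tester_def)
    then have "pmf (run_algorithm m A (uniform_hypercube n)) Truncated \<le> 1 / 100"
      using total[of "run_algorithm m A (uniform_hypercube n)"] by linarith
    moreover have "pmf (run_algorithm m A (uniform_hypercube n)) Truncated =
        (\<Sum>xs\<in>samples X m. (1 / real (card X)) ^ m * pmf (A xs) Truncated)"
      using finite_X X_nonempty unfolding unif
      by (intro pmf_run_algorithm_const[where P = "\<lambda>_. True", simplified]) auto
    ultimately have "(1 / real (card X)) ^ m * (\<Sum>xs\<in>samples X m. pmf (A xs) Truncated) \<le> 1 / 100"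
      by (simp only: sum_distrib_left)
    then show "(\<Sum>xs\<in>samples X m. pmf (A xs) Truncated) \<le> 1 / 100 * real (card X) ^ m"
      using card_X_pos by (simp add: power_one_over field_simps)
  next
    fix a assume a: "generic a"
    define f :: "point \<Rightarrow> real" where "f x = of_bool (dot J a (\<phi> x) \<ge> 0)" for x
    obtain p where "p \<in> mpolys_upto n d" "\<And>x. mpoly_eval p x = dot J a (\<phi> x)"
      using multilinear_mpoly_exists[OF J(1,3,4), of a] by (auto simp: dot_def \<phi>_def)
    then have ptf: "is_ptf n d f"
      unfolding is_ptf_def f_def by (intro bexI[of _ p]) auto
    have half: "2 * (\<Sum>x\<in>X. f x) = real (card X)"
      using sum_half[OF a, of "\<lambda>_. 1"] by (simp add: f_def sum_distrib_left)
    have vol: "vol n f = 1 / 2"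
      unfolding vol_def unif using half card_X_pos
      by (subst integral_pmf_of_set[OF X_nonempty finite_X]) (simp add: field_simps)
    have "pmf (run_algorithm m A (truncated_uniform n f)) Truncated \<ge> 99 / 100"
      using tester ptf vol by (simp add: truncation_tester_def)
    moreover have "pmf (run_algorithm m A (truncated_uniform n f)) Truncated =
        (\<Sum>xs\<in>samples X m. (2 / real (card X)) ^ m * of_bool (\<forall>x\<in>set xs. dot J a (\<phi> x) \<ge> 0) * pmf (A xs) Truncated)"
    proof -
      have card_pos: "2 * card (X \<inter> {x. f x = 1}) = card X"
      proof -
        have "(\<Sum>x\<in>X. f x) = real (card (X \<inter> {x. f x = 1}))"
          using finite_X by (simp add: f_def sum_of_bool_eq Int_def)
        then show ?thesis using half by linarith
      qed
      then have "X \<inter> {x. f x = 1} \<noteq> {}" using card_X_pos by auto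
      then have nonempty: "set_pmf (pmf_of_set X) \<inter> {x. f x = 1} \<noteq> {}"
        using finite_X X_nonempty by simp
      have prob_half: "measure (pmf_of_set X) {x. f x = 1} = 1 / 2"
        using finite_X X_nonempty card_X_pos card_pos by (simp add: measure_pmf_of_set field_simps flip: of_nat_mult)
      then have pmf: "pmf (truncated_uniform n f) x = 2 / real (card X) * of_bool (dot J a (\<phi> x) \<ge> 0)"
        if "x \<in> X" for x
        using that finite_X X_nonempty unfolding truncated_uniform_def unif pmf_cond[OF nonempty] prob_half
        by (simp add: f_def)
      show ?thesis
        using finite_X X_nonempty nonempty pmf
        by (intro pmf_run_algorithm_const) (auto simp: truncated_uniform_def unif)
    qed
    ultimately have "99 / 100 * real (card X) ^ m \<le> real (card X) ^ m *
        (\<Sum>xs\<in>samples X m. (2 / real (card X)) ^ m * of_bool (\<forall>x\<in>set xs. dot J a (\<phi> x) \<ge> 0) * pmf (A xs) Truncated)"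
      using card_X_pos by simp
    also have "\<dots> = (\<Sum>xs\<in>samples X m. 2 ^ m * of_bool (\<forall>x\<in>set xs. dot J a (\<phi> x) \<ge> 0) * pmf (A xs) Truncated)"
      unfolding sum_distrib_left using card_X_pos by (intro sum.cong refl) (simp add: power_divide)
    finally show "99 / 100 * real (card X) ^ m \<le>
        (\<Sum>xs\<in>samples X m. 2 ^ m * of_bool (\<forall>x\<in>set xs. dot J a (\<phi> x) \<ge> 0) * pmf (A xs) Truncated)" .
  qed
qed

theorem theorem4p2:
  fixes d :: nat
  assumes "d \<ge> 1"
  shows "\<exists>(\<delta> :: nat \<Rightarrow> real) (c :: real).
           (\<forall>n. \<delta> n \<in> {0..1}) \<and> \<delta> \<longlonglongrightarrow> 0 \<and> c > 0 \<and>
           (\<forall>\<^sub>F n in sequentially. \<forall>m A.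
              truncation_tester n d (\<delta> n) m A \<longrightarrow> real m \<ge> c * real n powr (real d / 2))"
proof -
  \<comment> \<open>For \<open>n \<ge> d\<close> the block length \<open>N\<close> is at least
    \<open>n / (2 * d)\<close>, and taking roots in \<open>N ^ d \<le> 4 * m\<^sup>2\<close> loses
    the factor \<open>1 / 2\<close>.\<close>
  define c where "c = 1 / 2 * (1 / (2 * real d)) powr (real d / 2)"
  have bound: "c * real n powr (real d / 2) \<le> real m"
    if n: "n \<ge> d" and tester: "truncation_tester n d 0 m A" for n m A
  proof -
    define N where "N = n div d"
    have N: "N > 0" using n assms by (simp add: N_def div_greater_zero_iff)
    from odd_block_family[OF assms, of n, folded N_def] obtain J B
      where "finite J" "card J = N ^ d" "B \<subseteq> {..<n}"
        and "\<forall>S\<in>J. S \<subseteq> {..<n} \<and> card S \<le> d \<and> odd (card (S \<inter> B))" by blast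
    moreover from this N have "J \<noteq> {}" by auto
    ultimately have D: "real N ^ d \<le> 4 * (real m)\<^sup>2"
      using truncation_tester_lower_bound[OF tester, of J B] by auto
    \<comment> \<open>Since \<open>N \<ge> 1\<close>, the rounding in \<open>n div d\<close> is
      absorbed by \<open>N + 1 \<le> 2 * N\<close>.\<close>
    have "n < d * (N + 1)"
      using assms dividend_less_times_div[of d n] by (simp add: N_def)
    also have "\<dots> \<le> d * (2 * N)" using N by (intro mult_left_mono) auto
    finally have "real n \<le> real (d * (2 * N))" by linarith
    then have "1 / (2 * real d) * real n \<le> real N"
      using assms by (simp add: field_simps)
    then have "(1 / (2 * real d) * real n) powr (real d / 2) \<le> real N powr (real d / 2)"
      by (intro powr_mono2) auto
    also have "\<dots> = sqrt (real N ^ d)"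
      using N by (simp add: powr_half_sqrt[symmetric] powr_powr powr_realpow[symmetric])
    also have "\<dots> \<le> 2 * real m"
      using D by (intro real_le_lsqrt) (auto simp: power2_eq_square)
    finally have "(1 / (2 * real d)) powr (real d / 2) * real n powr (real d / 2) \<le> 2 * real m"
      by (subst (asm) powr_mult) auto
    then show ?thesis
      by (simp add: c_def)
  qed
  have "c > 0" using assms by (simp add: c_def)
  moreover have "\<forall>\<^sub>F n in sequentially. \<forall>m A. truncation_tester n d 0 m A \<longrightarrow> real m \<ge> c * real n powr (real d / 2)"
    using eventually_ge_at_top[of d] by eventually_elim (use bound in blast)
  ultimately show ?thesis
    by (intro exI[of _ "\<lambda>_. 0"] exI[of _ c]) auto
qed

end
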